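(* For all $0\le\gamma<1$, $$\Lambda\ \ge\ \limsup_{N\to\infty}\widehat\Delta_N ,$$ where $\Lambda$ is the spectral gap of the linearized Kac-Boltzmann operator and $\widehat\Delta_N$ is the restricted spectral gap of the Kac walk, both with the same exponent $\gamma$, as defined in the context.
   Context: Linearized operator: let $M(v)=\frac1{\sqrt{2\pi}}e^{-v^2/2}$ on $\mathbb R$, and write $v_*=v\cos\theta+w\sin\theta$, $w_*=-v\sin\theta+w\cos\theta$. The linearized Kac-Boltzmann operator is $$\mathcal Lh(v)=\frac1\pi\int_{\mathbb R}\int_{-\pi}^{\pi}(v^2+w^2)^\gamma\,[h(v_* )+h(w_* )-h(v)-h(w)]\,M(w)\,d\theta\,dw,$$ with quadratic form $$\langle h,\mathcal Lh\rangle=\frac1\pi\int_{\mathbb R}\int_{\mathbb R}\int_{-\pi}^{\pi}(v^2+w^2)^\gamma[h(v)h(v_* )+h(v)h(w_* )-h^2(v)-h(v)h(w)]M(v)M(w)\,d\theta\,dw\,dv .$$ Its spectral gap is $$\Lambda=\inf\left\{-\frac{\langle h,\mathcal Lh\rangle}{\|h\|^2_{L^2(\mathbb R,M\,dv)}}:\ \int_{\mathbb R}h\,M\,dv=\int_{\mathbb R}v^2h\,M\,dv=0\right\},$$ the infimum being over nonzero $h\in L^2(\mathbb R,M\,dv)$ for which the integral defining the quadratic form converges absolutely. Kac walk: for $N\ge 2$ let $S^{N-1}(\sqrt N)=\{v\in\mathbb R^N:\sum_{j=1}^N v_j^2=N\}$ with the uniform probability measure $\sigma$; $\langle\cdot,\cdot\rangle$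 and $\|\cdot\|_2$ on this sphere are those of $L^2(S^{N-1}(\sqrt N),\sigma)$. For $i<j$ and an angle $\theta$ let $R_{i,j,\theta}v$ be the vector with $i$-th coordinate $v_i\cos\theta+v_j\sin\theta$, $j$-th coordinate $-v_i\sin\theta+v_j\cos\theta$, and all other coordinates equal to those of $v$. Put $[f]^{(i,j)}(v)=\frac1{2\pi}\int_{-\pi}^{\pi}f(R_{i,j,\theta}v)\,d\theta$ and $$\mathcal E_N(f,f)=N\binom N2^{-1}\sum_{i<j}\int_{S^{N-1}(\sqrt N)}(v_i^2+v_j^2)^\gamma\,(f-[f]^{(i,j)})^2\,d\sigma .$$ Let $\mathcal A_N$ be the subspace of $L^2(S^{N-1}(\sqrt N),\sigma)$ of functions of the form $f(v)=\sum_{j=1}^N\varphi(v_j)$. Then $$\widehat\Delta_N=\inf\{\mathcal E_N(f,f):\ \|f\|_2=1,\ \langle f,1\rangle=0,\ f\in\mathcal A_N\}.$$ *)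

theory Defs
  imports "HOL-Probability.Probability"
begin

text \<open>
  Elements of \<open>L\<^sup>2\<close> spaces are rendered by measurable representatives.
  Indices of vectors in \<open>\<real>\<^sup>N\<close> run over \<open>{..<N}\<close>.
  In Isabelle \<open>0 powr 0 = 0\<close>; for \<open>\<gamma> = 0\<close> the factors \<open>(v\<^sup>2 + w\<^sup>2) powr \<gamma>\<close>
  below therefore differ from the constant \<open>1\<close> only on null sets.
\<close>

definition L2_space :: "'a measure \<Rightarrow> ('a \<Rightarrow> real) set" where
  "L2_space M = {f \<in> borel_measurable M. integrable M (\<lambda>x. (f x)\<^sup>2)}"


section \<open>The linearized Kac-Boltzmann operator\<close>

definition maxwellian :: "real measure" where
  "maxwellian = density lborel (\<lambda>v. ennreal (std_normal_density v))"

definition form_integrand :: "real \<Rightarrow> (real \<Rightarrow> real) \<Rightarrow> real \<times> real \<times> real \<Rightarrow> real" where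
  "form_integrand \<gamma> h = (\<lambda>(v, w, \<theta>).
     let v' = v * cos \<theta> + w * sin \<theta>; w' = - v * sin \<theta> + w * cos \<theta>
     in (v\<^sup>2 + w\<^sup>2) powr \<gamma> * (h v * h v' + h v * h w' - (h v)\<^sup>2 - h v * h w)
        * std_normal_density v * std_normal_density w)"

definition form_converges :: "real \<Rightarrow> (real \<Rightarrow> real) \<Rightarrow> bool" where
  "form_converges \<gamma> h \<longleftrightarrow>
     set_integrable lborel (UNIV \<times> UNIV \<times> {-pi..pi}) (form_integrand \<gamma> h)"

text \<open>The quadratic form \<open>\<langle>h, \<L>h\<rangle>\<close> in \<open>L\<^sup>2(\<real>, M dv)\<close>.\<close>

definition linearized_form :: "real \<Rightarrow> (real \<Rightarrow> real) \<Rightarrow> real" where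
  "linearized_form \<gamma> h =
     1 / pi * (LINT p:(UNIV \<times> UNIV \<times> {-pi..pi})|lborel. form_integrand \<gamma> h p)"

definition linearized_gap :: "real \<Rightarrow> ereal" where
  "linearized_gap \<gamma> =
     (INF h \<in> {h \<in> L2_space maxwellian.
                 \<not> (AE v in maxwellian. h v = 0) \<and> form_converges \<gamma> h \<and>
                 (LINT v|maxwellian. h v) = 0 \<and> (LINT v|maxwellian. v\<^sup>2 * h v) = 0}.
        ereal (- linearized_form \<gamma> h / (LINT v|maxwellian. (h v)\<^sup>2)))"


section \<open>The Kac walk\<close>

text \<open>
  The uniform probability measure on the sphere of radius \<open>\<surd>N\<close> in \<open>\<real>\<^sup>N\<close>: the image of the
  normalized Lebesgue measure on the unit ball under radial projection (the cone construction of
  normalized surface measure).  It is a measure on all of \<open>\<real>\<^sup>N\<close>, concentrated on the sphere;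
  the value of the projection at the origin is irrelevant.
\<close>

definition sphere_measure :: "nat \<Rightarrow> (nat \<Rightarrow> real) measure" where
  "sphere_measure N =
     (let R = (\<Pi>\<^sub>M i\<in>{..<N}. (lborel :: real measure))
      in distr (uniform_measure R {x \<in> space R. (\<Sum>k<N. (x k)\<^sup>2) \<le> 1})
           (\<Pi>\<^sub>M i\<in>{..<N}. borel)
           (\<lambda>x. \<lambda>i\<in>{..<N}. sqrt (real N) * x i / sqrt (\<Sum>k<N. (x k)\<^sup>2)))"

definition kac_rotation :: "nat \<Rightarrow> nat \<Rightarrow> real \<Rightarrow> (nat \<Rightarrow> real) \<Rightarrow> nat \<Rightarrow> real" where
  "kac_rotation i j \<theta> v =
     v(i := v i * cos \<theta> + v j * sin \<theta>, j := - v i * sin \<theta> + v j * cos \<theta>)"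

definition kac_average ::
    "nat \<Rightarrow> nat \<Rightarrow> ((nat \<Rightarrow> real) \<Rightarrow> real) \<Rightarrow> (nat \<Rightarrow> real) \<Rightarrow> real" where
  "kac_average i j f v =
     1 / (2 * pi) * (LINT \<theta>:{-pi..pi}|lborel. f (kac_rotation i j \<theta> v))"

definition kac_form :: "real \<Rightarrow> nat \<Rightarrow> ((nat \<Rightarrow> real) \<Rightarrow> real) \<Rightarrow> real" where
  "kac_form \<gamma> N f =
     real N / real (N choose 2) *
       (\<Sum>(i, j) \<in> {(i, j). i < j \<and> j < N}.
          LINT v|sphere_measure N.
            ((v i)\<^sup>2 + (v j)\<^sup>2) powr \<gamma> * (f v - kac_average i j f v)\<^sup>2)"

definition additive_functions :: "nat \<Rightarrow> ((nat \<Rightarrow> real) \<Rightarrow> real) set" where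
  "additive_functions N =
     {f \<in> L2_space (sphere_measure N).
        \<exists>\<phi> \<in> borel_measurable (borel :: real measure).
          AE v in sphere_measure N. f v = (\<Sum>j<N. \<phi> (v j))}"

definition restricted_kac_gap :: "real \<Rightarrow> nat \<Rightarrow> ereal" where
  "restricted_kac_gap \<gamma> N =
     (INF f \<in> {f \<in> additive_functions N.
                 sqrt (LINT v|sphere_measure N. (f v)\<^sup>2) = 1 \<and>
                 (LINT v|sphere_measure N. f v) = 0}.
        ereal (kac_form \<gamma> N f))"

end

theory Submission
  imports Defs "HOL-Real_Asymp.Real_Asymp"
begin

text \<open>
  For \<open>h\<close> admissible in the linearized problem take the trial function \<open>\<Sum>\<^sub>k (h (v\<^sub>k) - m\<^sub>N)\<close>, \<open>m\<^sub>N\<close> the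
  mean of \<open>h (v\<^sub>1)\<close> on the sphere.  The law of a pair of coordinates has an explicit density,
  whose quotient by the Gaussian is bounded by a constant and equals \<open>1 + O(1/N)\<close> with a coefficient
  that is a quadratic polynomial in \<open>v\<^sup>2 + w\<^sup>2\<close>.  As \<open>h\<close> is orthogonal to \<open>1\<close> and \<open>v\<^sup>2\<close>, the correlation of
  \<open>h (v\<^sub>1)\<close> and \<open>h (v\<^sub>2)\<close> is \<open>o(1/N)\<close>, and the variance of the trial function is asymptotic to
  \<open>N \<parallel>h\<parallel>\<^sup>2\<close>.  Its Kac form divided by \<open>N\<close> tends to the Gaussian integral of \<open>(v\<^sup>2 + w\<^sup>2)\<^sup>\<gamma> X\<^sup>2\<close> by dominated
  convergence, where \<open>X\<close> is \<open>h (v) + h (w)\<close> minus its mean over the circle through \<open>(v, w)\<close>; by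
  rotation invariance of the Gaussian this integral is \<open>- \<langle>h, \<L>h\<rangle>\<close>.
\<close>

text \<open>The variance of a sum over N coordinates contains N(N-1) correlations, so one of order
  1/N would change its leading term. This is why the pair law is needed to order 1/N and where both
  constraints on \<open>h\<close> act: the coefficient is 2x - x^2/4 with x = v^2 + w^2, each of its
  monomials other than v^2 w^2 is constant in v or in w and is removed by orthogonality to 1, and
  v^2 w^2 is removed by orthogonality to v^2. The mean of one coordinate is in general only O(1/N),
  since the moment of \<open>h\<close> against v^4 is unrestricted, but N times its square still
  tends to 0. The uniform bound on the density quotient lets an arbitrary admissible
  \<open>h\<close> be used as it stands, without truncation. What remains is a gap in integrability:
  admissibility gives absolute convergence of h(v) times the collision difference, whereas the Kac
  form contains a square. Symmetrizing in v and w and averaging over circles about the origin closes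
  it, because the product and the square then have the same nonnegative mean on almost every
  circle.\<close>

section \<open>The law of two coordinates on the sphere\<close>

text \<open>The substitution \<open>a = t / sqrt (1 - t\<^sup>2)\<close> maps (-1, 1) onto the line
  with derivative \<open>(1 - t\<^sup>2) powr (-3/2)\<close>. It is carried out through its inverse
  \<open>g\<close> on [-n, n], and monotone convergence removes the cutoff.\<close>

lemma nn_integral_subst_ball:
  fixes F :: "real \<Rightarrow> ennreal"
  assumes [measurable]: "F \<in> borel_measurable borel"
  shows "(\<integral>\<^sup>+a. F a \<partial>lborel) =
    (\<integral>\<^sup>+t. F (t / sqrt (1 - t\<^sup>2)) * ennreal ((1 - t\<^sup>2) powr (-3/2)) * indicator {-1<..<1} t \<partial>lborel)"
proof -
  define g where "g a = a / sqrt (1 + a\<^sup>2)" for a :: real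
  define f where "f t = F (t / sqrt (1 - t\<^sup>2)) * ennreal ((1 - t\<^sup>2) powr (-3/2)) * indicator {-1<..<1} t" for t :: real
  have [measurable]: "f \<in> borel_measurable borel" unfolding f_def by measurable
  have pos: "1 + a\<^sup>2 > 0" for a :: real by (simp add: add_pos_nonneg)
  have g1: "1 - (g a)\<^sup>2 = 1 / (1 + a\<^sup>2)" for a
    using pos[of a] by (simp add: g_def power_divide field_simps)
  have gb: "g a \<in> {-1<..<1}" for a
  proof -
    have "(g a)\<^sup>2 < 1\<^sup>2" using g1[of a] pos[of a] by (smt (verit) divide_pos_pos one_power2)
    then have "\<bar>g a\<bar> < 1" using abs_square_less_1 by auto
    then show ?thesis by auto
  qed
  have ginv: "g a / sqrt (1 - (g a)\<^sup>2) = a" for a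
    unfolding g1 using pos[of a] by (simp add: g_def real_sqrt_divide)
  have fg: "f (g a) * ennreal ((1 + a\<^sup>2) powr (-3/2)) = F a" for a
  proof -
    have "(1 / (1 + a\<^sup>2)) powr (-3/2) * (1 + a\<^sup>2) powr (-3/2) = 1"
      using pos[of a] by (simp add: powr_divide)
    then show ?thesis
      using gb[of a] by (simp add: f_def ginv) (simp add: g1 mult.assoc ennreal_mult[symmetric])
  qed
  have dg: "(g has_real_derivative (1 + a\<^sup>2) powr (-3/2)) (at a)" for a
  proof -
    have "(1 + a\<^sup>2) powr (-3/2) = 1 / ((1 + a\<^sup>2) * sqrt (1 + a\<^sup>2))"
    proof -
      have "(1 + a\<^sup>2) powr (-3/2) = (1 + a\<^sup>2) powr (-1) * (1 + a\<^sup>2) powr (-(1/2))"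
        by (subst powr_add[symmetric]) simp
      then show ?thesis 
        using pos[of a] unfolding powr_minus by (simp add: powr_half_sqrt inverse_eq_divide)
    qed
    moreover have "((\<lambda>a. a / sqrt (1 + a\<^sup>2)) has_real_derivative 1 / ((1 + a\<^sup>2) * sqrt (1 + a\<^sup>2))) (at a)"
      using pos[of a] by (auto intro!: derivative_eq_intros simp: field_simps power2_eq_square)
    ultimately show ?thesis unfolding g_def[abs_def] by simp
  qed
  have gm: "strict_mono g"
    unfolding strict_mono_def using DERIV_pos_imp_increasing dg pos
    by (metis powr_gt_zero less_irrefl)
  have sub: "(\<integral>\<^sup>+x. f x * indicator {g (- real n)..g (real n)} x \<partial>lborel) = (\<integral>\<^sup>+x. F x * indicator {-real n..real n} x \<partial>lborel)"
    for n :: nat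
  \<comment> \<open>The substitution rule asks for a nondegenerate interval; at \<open>n = 0\<close>
    both integrals run over the null set {0}.\<close>
  proof (cases "n = 0")
    case True
    have "AE x in lborel. x \<noteq> (0::real)" by (rule AE_lborel_singleton)
    then show ?thesis unfolding True by (auto simp: g_def intro!: nn_integral_cong_AE elim!: eventually_mono split: split_indicator)
  next
    case False
    have "(\<integral>\<^sup>+x. f x * indicator {g (- real n)..g (real n)} x \<partial>lborel) =
      (\<integral>\<^sup>+x. f (g x) * ennreal ((1 + x\<^sup>2) powr (-3/2)) * indicator {-real n..real n} x \<partial>lborel)"
      using False pos by (intro nn_integral_substitution_aux dg) (auto intro!: continuous_intros simp: less_imp_neq[THEN not_sym])
    then show ?thesis by (simp only: fg)
  qed
  have surj: "\<exists>a. g a = t" if "t \<in> {-1<..<1}" for t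
  proof (rule exI)
    have "1 - t\<^sup>2 > 0" using that by (simp add: abs_square_less_1 abs_less_iff)
    then show "g (t / sqrt (1 - t\<^sup>2)) = t"
      by (simp add: g_def power_divide field_simps real_sqrt_divide)
  qed
  have L: "(\<lambda>n. \<integral>\<^sup>+x. F x * indicator {-real n..real n} x \<partial>lborel) \<longlonglongrightarrow> (\<integral>\<^sup>+x. F x \<partial>lborel)"
  proof (rule nn_integral_LIMSEQ)
    show "incseq (\<lambda>n x. F x * indicator {-real n..real n} x)"
      by (auto simp: incseq_def le_fun_def split: split_indicator)
    fix x :: real
    have "eventually (\<lambda>n. F x * indicator {-real n..real n} x = F x) sequentially"
      using eventually_ge_at_top[of "nat \<lceil>\<bar>x\<bar>\<rceil>"]
      by eventually_elim (auto split: split_indicator simp: nat_le_iff ceiling_le_iff abs_le_iff)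
    then show "(\<lambda>n. F x * indicator {-real n..real n} x) \<longlonglongrightarrow> F x"
      by (rule tendsto_eventually)
  qed auto
  have R: "(\<lambda>n. \<integral>\<^sup>+x. f x * indicator {g (-real n)..g (real n)} x \<partial>lborel) \<longlonglongrightarrow> (\<integral>\<^sup>+x. f x \<partial>lborel)"
  proof (rule nn_integral_LIMSEQ)
    have "g (real n) \<le> g (real m)" "g (- real m) \<le> g (- real n)" if "n \<le> m" for n m
      using gm that by (simp_all add: strict_mono_less_eq)
    then show "incseq (\<lambda>n x. f x * indicator {g (-real n)..g (real n)} x)"
      by (fastforce simp: incseq_def le_fun_def split: split_indicator)
    fix x :: real
    have "eventually (\<lambda>n. f x * indicator {g (-real n)..g (real n)} x = f x) sequentially"
    proof (cases "x \<in> {-1<..<1}")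
      case True
      then obtain a where a: "x = g a" using surj by auto
      show ?thesis
        using eventually_ge_at_top[of "nat \<lceil>\<bar>a\<bar>\<rceil>"]
        by eventually_elim (auto split: split_indicator simp: a strict_mono_less_eq[OF gm] nat_le_iff ceiling_le_iff abs_le_iff)
    qed (auto simp: f_def)
    then show "(\<lambda>n. f x * indicator {g (-real n)..g (real n)} x) \<longlonglongrightarrow> f x"
      by (rule tendsto_eventually)
  qed auto
  show ?thesis
    using LIMSEQ_unique[OF R[unfolded sub] L] by (simp add: f_def)
qed

text \<open>Tonelli splits off one coordinate at a time, and each one-dimensional scaling
  contributes a factor \<open>c\<close>. It serves to rescale the coordinates outside the chosen
  pair.\<close>

lemma nn_integral_PiM_lborel_scale:
  fixes F :: "('i \<Rightarrow> real) \<Rightarrow> ennreal"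
  assumes "finite I" and [measurable]: "F \<in> borel_measurable (\<Pi>\<^sub>M i\<in>I. lborel)" and c: "c > 0"
  shows "(\<integral>\<^sup>+y. F y \<partial>(\<Pi>\<^sub>M i\<in>I. lborel)) = ennreal (c ^ card I) * (\<integral>\<^sup>+y. F (\<lambda>i\<in>I. c * y i) \<partial>(\<Pi>\<^sub>M i\<in>I. lborel))"
  using assms(1,2)
proof (induction I arbitrary: F rule: finite_induct)
  interpret product_sigma_finite "\<lambda>_. lborel :: real measure" by standard
  case empty
  then show ?case by (simp add: PiM_empty nn_integral_count_space_finite restrict_def)
next
  interpret product_sigma_finite "\<lambda>_. lborel :: real measure" by standard
  case (insert k I)
  note [measurable] = insert.prems
  have IH: "(\<integral>\<^sup>+y. G y \<partial>(\<Pi>\<^sub>M i\<in>I. lborel)) = ennreal (c ^ card I) * (\<integral>\<^sup>+y. G (\<lambda>i\<in>I. c * y i) \<partial>(\<Pi>\<^sub>M i\<in>I. lborel))"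
    if "G \<in> borel_measurable (\<Pi>\<^sub>M i\<in>I. lborel)" for G using insert.IH[OF that] .
  have upd: "(\<lambda>i\<in>I. c * y i)(k := c * x) = (\<lambda>i\<in>insert k I. c * (y(k := x)) i)" for y x
    using insert.hyps by (auto simp: fun_eq_iff)
  have m[measurable]: "(\<lambda>(y, x). F (y(k := x))) \<in> borel_measurable ((\<Pi>\<^sub>M i\<in>I. lborel) \<Otimes>\<^sub>M lborel)"
    by measurable
  have "(\<integral>\<^sup>+y. F y \<partial>(\<Pi>\<^sub>M i\<in>insert k I. lborel)) = (\<integral>\<^sup>+y. (\<integral>\<^sup>+x. F (y(k := x)) \<partial>lborel) \<partial>(\<Pi>\<^sub>M i\<in>I. lborel))"
    using insert.hyps by (intro product_nn_integral_insert) auto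
  also have "\<dots> = (\<integral>\<^sup>+y. ennreal c * (\<integral>\<^sup>+x. F (y(k := c * x)) \<partial>lborel) \<partial>(\<Pi>\<^sub>M i\<in>I. lborel))"
    by (intro nn_integral_cong, subst nn_integral_real_affine[where c=c and t=0])
       (use c in \<open>auto\<close>)
  also have "\<dots> = ennreal c * (\<integral>\<^sup>+y. (\<integral>\<^sup>+x. F (y(k := c * x)) \<partial>lborel) \<partial>(\<Pi>\<^sub>M i\<in>I. lborel))"
    by (intro nn_integral_cmult) measurable
  also have "(\<integral>\<^sup>+y. (\<integral>\<^sup>+x. F (y(k := c * x)) \<partial>lborel) \<partial>(\<Pi>\<^sub>M i\<in>I. lborel)) =
      ennreal (c ^ card I) * (\<integral>\<^sup>+y. (\<integral>\<^sup>+x. F ((\<lambda>i\<in>I. c * y i)(k := c * x)) \<partial>lborel) \<partial>(\<Pi>\<^sub>M i\<in>I. lborel))"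
    by (rule IH) measurable
  also have "(\<integral>\<^sup>+y. (\<integral>\<^sup>+x. F ((\<lambda>i\<in>I. c * y i)(k := c * x)) \<partial>lborel) \<partial>(\<Pi>\<^sub>M i\<in>I. lborel)) =
     (\<integral>\<^sup>+y. F (\<lambda>i\<in>insert k I. c * y i) \<partial>(\<Pi>\<^sub>M i\<in>insert k I. lborel))"
    unfolding upd using insert.hyps by (intro product_nn_integral_insert[symmetric]) auto
  finally show ?case
    unfolding card_insert_disjoint[OF insert.hyps] power_Suc using c by (simp only: mult.assoc[symmetric] ennreal_mult zero_le_power less_imp_le)
qed

lemma square_powr: "0 < s \<Longrightarrow> (s\<^sup>2) powr (x / 2) = s powr x" for s x :: real
  by (simp add: powr_def ln_realpow)

text \<open>The map sends the plane onto the open unit disc: it is the inverse of the gnomonic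
  projection of a hemisphere, followed by orthogonal projection onto the equatorial plane. With r^2
  = a^2 + b^2 its Jacobian is (1 + r^2)^(-2), and 1 - p^2 - q^2 = 1/(1 + r^2), which turns the
  exponent -m/2 into (m - 4)/2. It is obtained from two one-dimensional substitutions separated by
  an exchange of the integrals.\<close>

lemma nn_integral_gnomonic_disc:
  fixes H :: "real \<times> real \<Rightarrow> ennreal" and m :: real
  assumes [measurable]: "H \<in> borel_measurable borel"
  shows "(\<integral>\<^sup>+b. \<integral>\<^sup>+a. H (a / sqrt (1 + a\<^sup>2 + b\<^sup>2), b / sqrt (1 + a\<^sup>2 + b\<^sup>2)) * ennreal ((1 + a\<^sup>2 + b\<^sup>2) powr (-m/2)) \<partial>lborel \<partial>lborel)
    = (\<integral>\<^sup>+p. \<integral>\<^sup>+q. H (p, q) * ennreal (max 0 (1 - p\<^sup>2 - q\<^sup>2) powr ((m - 4) / 2)) \<partial>lborel \<partial>lborel)"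
proof -
  have [measurable]: "H \<in> borel_measurable (lborel \<Otimes>\<^sub>M lborel)" "H \<in> borel_measurable (borel \<Otimes>\<^sub>M borel)"
    using assms by (simp_all add: borel_prod lborel_prod)
  have pos: "1 + b\<^sup>2 > 0" for b :: real by (simp add: add_pos_nonneg)
  have ball: "1 - p\<^sup>2 > 0" if "p \<in> {-1<..<1}" for p :: real
    using that by (simp add: abs_square_less_1 abs_less_iff)
  \<comment> \<open>At fixed \<open>b\<close>, scaling \<open>a\<close> by
    \<open>sqrt (1 + b\<^sup>2)\<close> factors \<open>1 + a\<^sup>2 + b\<^sup>2\<close> into a
    function of \<open>b\<close> times \<open>1 + a\<^sup>2\<close>, so that the one-dimensional
    substitution applies.\<close>
  have inner: "(\<integral>\<^sup>+a. H (a / sqrt (1 + a\<^sup>2 + b\<^sup>2), b / sqrt (1 + a\<^sup>2 + b\<^sup>2)) * ennreal ((1 + a\<^sup>2 + b\<^sup>2) powr (-m/2)) \<partial>lborel)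
    = (\<integral>\<^sup>+p. H (p, b / sqrt (1 + b\<^sup>2) * sqrt (1 - p\<^sup>2)) * ennreal ((1 + b\<^sup>2) powr ((1 - m)/2) * (1 - p\<^sup>2) powr ((m-3)/2)) * indicator {-1<..<1} p \<partial>lborel)" (is "?L = ?R") for b
  proof -
    define s where "s = sqrt (1 + b\<^sup>2)"
    have s: "s > 0" "s\<^sup>2 = 1 + b\<^sup>2" using pos[of b] by (simp_all add: s_def)
    have sq: "1 + (s * a)\<^sup>2 + b\<^sup>2 = s\<^sup>2 * (1 + a\<^sup>2)" for a
      using s(2) by (simp add: power_mult_distrib algebra_simps)
    have "?L = ennreal s * (\<integral>\<^sup>+a. H (a / sqrt (1 + a\<^sup>2), b / (s * sqrt (1 + a\<^sup>2))) * ennreal ((s\<^sup>2 * (1 + a\<^sup>2)) powr (-m/2)) \<partial>lborel)"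
    proof (subst nn_integral_real_affine[where c=s and t=0], goal_cases)
      case 3
      show ?case using s(1) by (simp add: sq real_sqrt_mult)
    qed (use s in auto)
    also have "\<dots> = (\<integral>\<^sup>+a. ennreal s * (H (a / sqrt (1 + a\<^sup>2), b / (s * sqrt (1 + a\<^sup>2))) * ennreal ((s\<^sup>2 * (1 + a\<^sup>2)) powr (-m/2))) \<partial>lborel)"
      by (rule nn_integral_cmult[symmetric]) measurable
    also have "\<dots> = ?R"
    proof (subst nn_integral_subst_ball, goal_cases)
      case 2
      show ?case
      proof (rule nn_integral_cong)
        fix p :: real
        define a where "a = p / sqrt (1 - p\<^sup>2)"
        show "ennreal s * (H (a / sqrt (1 + a\<^sup>2), b / (s * sqrt (1 + a\<^sup>2))) * ennreal ((s\<^sup>2 * (1 + a\<^sup>2)) powr (-m/2)))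
             * ennreal ((1 - p\<^sup>2) powr (-3/2)) * indicator {-1<..<1} p
          = H (p, b / sqrt (1 + b\<^sup>2) * sqrt (1 - p\<^sup>2)) * ennreal ((1 + b\<^sup>2) powr ((1 - m)/2) * (1 - p\<^sup>2) powr ((m-3)/2)) * indicator {-1<..<1} p"
        proof (cases "p \<in> {-1<..<1}")
          case True
          note P = ball[OF True]
          have a2: "1 + a\<^sup>2 = 1 / (1 - p\<^sup>2)" using P by (simp add: a_def power_divide field_simps)
          have e1: "a / sqrt (1 + a\<^sup>2) = p" unfolding a2 using P by (simp add: a_def real_sqrt_divide)
          have e2: "b / (s * sqrt (1 + a\<^sup>2)) = b / sqrt (1 + b\<^sup>2) * sqrt (1 - p\<^sup>2)"
            unfolding a2 s_def by (simp add: real_sqrt_divide)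
          have e3: "(s\<^sup>2 * (1 + a\<^sup>2)) powr (-m/2) = s powr (-m) * (1 - p\<^sup>2) powr (m/2)"
            unfolding a2 using s(1) P by (simp add: powr_mult powr_divide powr_minus_divide square_powr)
          have e4: "s * (s powr (-m) * (1 - p\<^sup>2) powr (m/2)) * (1 - p\<^sup>2) powr (-3/2)
            = (1 + b\<^sup>2) powr ((1 - m)/2) * (1 - p\<^sup>2) powr ((m-3)/2)"
          proof -
            have "(1 + b\<^sup>2) powr ((1 - m)/2) = s powr (1 - m)"
              unfolding s(2)[symmetric] square_powr[OF s(1)] by simp
            moreover have "s powr (1 - m) = s * s powr (-m)"
              using s by (simp add: powr_diff powr_minus_divide)
            moreover have "(1 - p\<^sup>2) powr ((m-3)/2) = (1 - p\<^sup>2) powr (m/2) * (1 - p\<^sup>2) powr (-3/2)"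
              by (subst powr_add[symmetric]) (simp add: diff_divide_distrib)
            ultimately show ?thesis by (simp only: mult_ac)
          qed
          show ?thesis
            unfolding e1 e2 e3 e4[symmetric] using s(1)
            by (simp add: ennreal_mult mult_ac)
        qed auto
      qed
    qed measurable
    finally show ?thesis .
  qed
  \<comment> \<open>At fixed \<open>p\<close>, with \<open>t = b / sqrt (1 + b\<^sup>2)\<close>, the
    value \<open>q = t * sqrt (1 - p\<^sup>2)\<close> sweeps a chord of the disc.\<close>
  have outer: "(\<integral>\<^sup>+b. H (p, b / sqrt (1 + b\<^sup>2) * sqrt (1 - p\<^sup>2)) * ennreal ((1 + b\<^sup>2) powr ((1 - m)/2) * (1 - p\<^sup>2) powr ((m-3)/2)) * indicator {-1<..<1} p \<partial>lborel)
    = (\<integral>\<^sup>+q. H (p, q) * ennreal (max 0 (1 - p\<^sup>2 - q\<^sup>2) powr ((m - 4) / 2)) \<partial>lborel)" (is "?L = ?R") for p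
  proof (cases "p \<in> {-1<..<1}")
    case False
    then have "1 - p\<^sup>2 \<le> 0" using abs_square_less_1[of p] by (auto simp: abs_less_iff)
    \<comment> \<open>Since \<open>0 powr x = 0\<close> for every \<open>x\<close>, the truncated
      power vanishes outside the open disc whatever the sign of its exponent.\<close>
    then have "max 0 (1 - p\<^sup>2 - q\<^sup>2) = 0" for q
      by (intro max_absorb1) (smt (verit) zero_le_power2)
    then show ?thesis using False by simp
  next
    case True
    define k where "k = sqrt (1 - p\<^sup>2)"
    have k: "k > 0" "k\<^sup>2 = 1 - p\<^sup>2" using ball[OF True] by (simp_all add: k_def)
    have "?R = ennreal k * (\<integral>\<^sup>+t. H (p, k * t) * ennreal (max 0 (1 - p\<^sup>2 - (k * t)\<^sup>2) powr ((m - 4) / 2)) \<partial>lborel)"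
    proof (subst nn_integral_real_affine[where c=k and t=0], goal_cases)
      case 3 show ?case using k(1) by simp
    qed (use k in auto)
    also have "\<dots> = (\<integral>\<^sup>+t. ennreal k * (H (p, k * t) * ennreal (max 0 (1 - p\<^sup>2 - (k * t)\<^sup>2) powr ((m - 4) / 2))) \<partial>lborel)"
      by (rule nn_integral_cmult[symmetric]) measurable
    finally have R: "?R = (\<integral>\<^sup>+t. ennreal k * (H (p, k * t) * ennreal (max 0 (1 - p\<^sup>2 - (k * t)\<^sup>2) powr ((m - 4) / 2))) \<partial>lborel)" .
    have "?L = ?R" unfolding R
    proof (subst nn_integral_subst_ball, goal_cases)
      case 2
      show ?case
      proof (rule nn_integral_cong)
        fix t :: real
        define b where "b = t / sqrt (1 - t\<^sup>2)"
        show "H (p, b / sqrt (1 + b\<^sup>2) * sqrt (1 - p\<^sup>2)) * ennreal ((1 + b\<^sup>2) powr ((1 - m)/2) * (1 - p\<^sup>2) powr ((m-3)/2)) * indicator {-1<..<1} p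
            * ennreal ((1 - t\<^sup>2) powr (-3/2)) * indicator {-1<..<1} t
          = ennreal k * (H (p, k * t) * ennreal (max 0 (1 - p\<^sup>2 - (k * t)\<^sup>2) powr ((m - 4) / 2)))"
        proof (cases "t \<in> {-1<..<1}")
          case T: True
          note P = ball[OF T]
          have b2: "1 + b\<^sup>2 = 1 / (1 - t\<^sup>2)" using P by (simp add: b_def power_divide field_simps)
          have e1: "b / sqrt (1 + b\<^sup>2) * sqrt (1 - p\<^sup>2) = k * t"
            unfolding b2 using P by (simp add: b_def real_sqrt_divide k_def)
          have e2: "max 0 (1 - p\<^sup>2 - (k * t)\<^sup>2) = k\<^sup>2 * (1 - t\<^sup>2)"
            using P k by (simp add: power_mult_distrib algebra_simps max_def flip: k(2))
          have e3: "(1 + b\<^sup>2) powr ((1 - m)/2) * (1 - p\<^sup>2) powr ((m-3)/2) * (1 - t\<^sup>2) powr (-3/2)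
            = k * (k\<^sup>2 * (1 - t\<^sup>2)) powr ((m - 4) / 2)"
          proof -
            have "(1 + b\<^sup>2) powr ((1 - m)/2) * (1 - t\<^sup>2) powr (-3/2) = (1 - t\<^sup>2) powr ((m-4)/2)"
            proof -
              have "(1 + b\<^sup>2) powr ((1 - m)/2) = (1 - t\<^sup>2) powr ((m - 1)/2)"
                
              proof -
                have "(1 / (1 - t\<^sup>2)) powr x = (1 - t\<^sup>2) powr (- x)" for x
                  using P by (simp add: powr_divide powr_minus_divide)
                moreover have "- ((1 - m)/2) = (m - 1)/2" by (simp add: diff_divide_distrib)
                ultimately show ?thesis unfolding b2 by (simp only:)
              qed
              
              moreover have "(m - 1)/2 + - 3/2 = (m - 4)/2" by (simp add: diff_divide_distrib)
              ultimately show ?thesis by (simp only: powr_add[symmetric])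
            qed
            moreover have "(1 - p\<^sup>2) powr ((m-3)/2) = k * (k\<^sup>2) powr ((m-4)/2)"
            proof -
              have "k * (k\<^sup>2) powr ((m-4)/2) = k powr 1 * k powr (m - 4)"
                unfolding square_powr[OF k(1)] using k(1) by simp
              also have "\<dots> = k powr (m - 3)" by (subst powr_add[symmetric]) simp
              also have "\<dots> = (k\<^sup>2) powr ((m-3)/2)" unfolding square_powr[OF k(1)] by simp
              finally show ?thesis using k(2) by simp
            qed
            moreover have "(k\<^sup>2 * (1 - t\<^sup>2)) powr ((m - 4) / 2) = (k\<^sup>2) powr ((m-4)/2) * (1 - t\<^sup>2) powr ((m-4)/2)"
              using P by (simp add: powr_mult)
            ultimately show ?thesis by (simp add: mult_ac)
          qed
          have "H (p, k * t) * ennreal ((1 + b\<^sup>2) powr ((1 - m)/2) * (1 - p\<^sup>2) powr ((m-3)/2)) * ennreal ((1 - t\<^sup>2) powr (-3/2))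
            = H (p, k * t) * ennreal (k * (k\<^sup>2 * (1 - t\<^sup>2)) powr ((m - 4) / 2))"
            unfolding e3[symmetric] by (simp add: ennreal_mult mult_ac)
          then show ?thesis
            unfolding e1 e2 using True T k(1) by (simp add: ennreal_mult mult_ac)
        next
          case T: False
          then have "1 \<le> t\<^sup>2" using abs_square_less_1[of t] by (auto simp: abs_less_iff)
          then have "k\<^sup>2 * 1 \<le> k\<^sup>2 * t\<^sup>2" using k(1) by (intro mult_left_mono) auto
          then have "max 0 (1 - p\<^sup>2 - (k * t)\<^sup>2) = 0" using k by (simp add: power_mult_distrib)
          then show ?thesis using T by simp
        qed
      qed
    qed measurable
    then show ?thesis .
  qed
  show ?thesis
    unfolding inner
    by (subst lborel_pair.Fubini') (measurable, simp only: outer)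
qed

text \<open>The exceptional set is the origin alone, a null set as soon as there is a coordinate. It
  is the point at which rescaling by the root of the sum of squares breaks down.\<close>

lemma AE_PiM_lborel_sum_squares_pos:
  assumes "finite I" "I \<noteq> {}"
  shows "AE y in (\<Pi>\<^sub>M i\<in>I. lborel :: real measure). 0 < (\<Sum>k\<in>I. (y k)\<^sup>2)"
proof (rule AE_I)
  interpret product_sigma_finite "\<lambda>_. lborel :: real measure" by standard
  show "{y \<in> space (\<Pi>\<^sub>M i\<in>I. lborel). \<not> 0 < (\<Sum>k\<in>I. (y k)\<^sup>2)} \<subseteq> (\<Pi>\<^sub>E i\<in>I. {0::real})"
  proof
    fix y :: "'a \<Rightarrow> real" assume y: "y \<in> {y \<in> space (\<Pi>\<^sub>M i\<in>I. lborel). \<not> 0 < (\<Sum>k\<in>I. (y k)\<^sup>2)}"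
    then have "(\<Sum>k\<in>I. (y k)\<^sup>2) = 0" by (simp add: not_less order_antisym sum_nonneg)
    then have "y k = 0" if "k \<in> I" for k using that assms(1) by (simp add: sum_nonneg_eq_0_iff)
    then show "y \<in> (\<Pi>\<^sub>E i\<in>I. {0})" using y by (auto simp: space_PiM PiE_iff extensional_def)
  qed
  show "(\<Pi>\<^sub>E i\<in>I. {0::real}) \<in> sets (\<Pi>\<^sub>M i\<in>I. lborel)"
    using assms(1) by (intro sets_PiM_I_finite) auto
  show "emeasure (\<Pi>\<^sub>M i\<in>I. lborel) (\<Pi>\<^sub>E i\<in>I. {0::real}) = 0"
    using assms by (subst emeasure_PiM) (auto simp: prod_zero_iff)
qed

text \<open>
  Write \<open>\<tau> = \<Sum>\<^sub>k\<^sub>\<noteq>\<^sub>i\<^sub>,\<^sub>j x\<^sub>k\<^sup>2\<close>.  Rescaling \<open>(x\<^sub>i, x\<^sub>j)\<close> by \<open>\<surd>\<tau>\<close> makes the homogeneous integrand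
  independent of the remaining coordinates, which then only contribute a power of \<open>1 + a\<^sup>2 + b\<^sup>2\<close>
  by a second rescaling.
\<close>

lemma nn_integral_ball_two_coordinates:
  fixes H :: "real \<times> real \<Rightarrow> ennreal"
  assumes [measurable]: "H \<in> borel_measurable borel" and ij: "i < N" "j < N" "i \<noteq> j" and N: "3 \<le> N"
  defines "I \<equiv> {..<N} - {i, j}"
  defines "R \<equiv> (\<Pi>\<^sub>M i\<in>{..<N}. lborel :: real measure)"
  shows "(\<integral>\<^sup>+x. H (x i / sqrt (\<Sum>k<N. (x k)\<^sup>2), x j / sqrt (\<Sum>k<N. (x k)\<^sup>2)) * indicator {..1} (\<Sum>k<N. (x k)\<^sup>2) \<partial>R)
    = (\<integral>\<^sup>+y. ennreal (\<Sum>k\<in>I. (y k)\<^sup>2) * indicator {..1} (\<Sum>k\<in>I. (y k)\<^sup>2) \<partial>(\<Pi>\<^sub>M i\<in>I. lborel)) *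
      (\<integral>\<^sup>+p. \<integral>\<^sup>+q. H (p, q) * ennreal (max 0 (1 - p\<^sup>2 - q\<^sup>2) powr ((real N - 4) / 2)) \<partial>lborel \<partial>lborel)"
proof -
  interpret product_sigma_finite "\<lambda>_. lborel :: real measure" by standard
  have [measurable]: "H \<in> borel_measurable (lborel \<Otimes>\<^sub>M lborel)" "H \<in> borel_measurable (borel \<Otimes>\<^sub>M borel)"
    using assms(1) by (simp_all add: borel_prod lborel_prod)
  define RI where "RI = (\<Pi>\<^sub>M i\<in>I. lborel :: real measure)"
  define T where "T y = (\<Sum>k\<in>I. (y k)\<^sup>2)" for y :: "nat \<Rightarrow> real"
  have finI: "finite I" and iI: "i \<notin> insert j I" and jI: "j \<notin> I"
    and NI: "{..<N} = insert i (insert j I)" and cardI: "card I = N - 2"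
    using ij by (auto simp: I_def card_Diff_subset)
  have T_pos: "T y \<ge> 0" for y by (simp add: T_def sum_nonneg)
  have [measurable]: "T \<in> borel_measurable RI" unfolding T_def[abs_def] RI_def by measurable
  interpret RI: sigma_finite_measure RI unfolding RI_def by (rule sigma_finite[OF finI])
  interpret RL: pair_sigma_finite RI "lborel :: real measure" by standard
  define K where "K = (\<integral>\<^sup>+y. ennreal (T y) * indicator {..1} (T y) \<partial>RI)"
  define f where "f x = H (x i / sqrt (\<Sum>k<N. (x k)\<^sup>2), x j / sqrt (\<Sum>k<N. (x k)\<^sup>2)) * indicator {..1} (\<Sum>k<N. (x k)\<^sup>2)" for x :: "nat \<Rightarrow> real"
  define \<Phi> where "\<Phi> \<tau> a b = H (a / sqrt (a\<^sup>2 + b\<^sup>2 + \<tau>), b / sqrt (a\<^sup>2 + b\<^sup>2 + \<tau>)) * indicator {..1} (a\<^sup>2 + b\<^sup>2 + \<tau>)" for \<tau> a b :: real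
  define \<Psi> where "\<Psi> a b = H (a / sqrt (1 + a\<^sup>2 + b\<^sup>2), b / sqrt (1 + a\<^sup>2 + b\<^sup>2))" for a b :: real
  have [measurable]: "f \<in> borel_measurable (\<Pi>\<^sub>M i\<in>insert i (insert j I). lborel)"
  proof -
    have [measurable]: "(\<lambda>x. x i) \<in> borel_measurable R" "(\<lambda>x. x j) \<in> borel_measurable R"
      using ij measurable_component_singleton[of _ "{..<N}" "\<lambda>_. lborel :: real measure"] by (auto simp: R_def)
    have [measurable]: "(\<lambda>x. \<Sum>k<N. (x k)\<^sup>2) \<in> borel_measurable R"
      using measurable_component_singleton[of _ "{..<N}" "\<lambda>_. lborel :: real measure"]
      by (intro borel_measurable_sum borel_measurable_power) (auto simp: R_def)
    have "f \<in> borel_measurable R" unfolding f_def[abs_def] by measurable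
    then show ?thesis unfolding R_def NI .
  qed
  have sumeq: "(\<Sum>k<N. ((y(j := b, i := a)) k)\<^sup>2) = a\<^sup>2 + b\<^sup>2 + T y" for y a b
    unfolding NI T_def using finI iI jI
    by (simp add: add_ac) (intro sum.cong, auto)
  have f_upd: "f (y(j := b, i := a)) = \<Phi> (T y) a b" for y a b
    unfolding f_def sumeq \<Phi>_def using ij by simp
  have pos: "1 + a\<^sup>2 + b\<^sup>2 > 0" for a b :: real by (simp add: add_pos_nonneg)
  \<comment> \<open>The area element of the rescaling by \<open>sqrt \<tau>\<close> is the factor
    \<open>\<tau>\<close>; it becomes the weight \<open>T y\<close> in \<open>K\<close>.\<close>
  have scale2: "(\<integral>\<^sup>+b. \<integral>\<^sup>+a. \<Phi> \<tau> a b \<partial>lborel \<partial>lborel)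
      = (\<integral>\<^sup>+b. \<integral>\<^sup>+a. \<Psi> a b * (ennreal \<tau> * indicator {..1} (\<tau> * (1 + a\<^sup>2 + b\<^sup>2))) \<partial>lborel \<partial>lborel)"
    if "\<tau> > 0" for \<tau>
  proof -
    define s where "s = sqrt \<tau>"
    have s: "s > 0" "s\<^sup>2 = \<tau>" using that by (simp_all add: s_def)
    have sq: "(s * a)\<^sup>2 + (s * b)\<^sup>2 + \<tau> = \<tau> * (1 + a\<^sup>2 + b\<^sup>2)" for a b
      by (simp add: s(2)[symmetric] power_mult_distrib algebra_simps)
    have \<Phi>s: "\<Phi> \<tau> (s * a) (s * b) = \<Psi> a b * indicator {..1} (\<tau> * (1 + a\<^sup>2 + b\<^sup>2))" for a b
      unfolding \<Phi>_def \<Psi>_def sq using s(1) by (simp add: real_sqrt_mult s_def[symmetric])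
    have [measurable]: "(\<lambda>x. \<Phi> \<tau> (fst x) (snd x)) \<in> borel_measurable (lborel \<Otimes>\<^sub>M lborel)"
      unfolding \<Phi>_def by measurable
    have "(\<integral>\<^sup>+b. \<integral>\<^sup>+a. \<Phi> \<tau> a b \<partial>lborel \<partial>lborel)
       = ennreal s * (\<integral>\<^sup>+b. \<integral>\<^sup>+a. \<Phi> \<tau> a (s * b) \<partial>lborel \<partial>lborel)"
    proof (subst nn_integral_real_affine[where c=s and t=0], goal_cases)
      case 3 show ?case using s(1) by simp
    qed (use s in \<open>auto simp: \<Phi>_def\<close>)
    also have "\<dots> = ennreal s * (\<integral>\<^sup>+b. ennreal s * (\<integral>\<^sup>+a. \<Phi> \<tau> (s * a) (s * b) \<partial>lborel) \<partial>lborel)"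
      by (intro arg_cong2[where f="(*)"] refl nn_integral_cong, subst nn_integral_real_affine[where c=s and t=0])
        (use s in \<open>auto simp: \<Phi>_def\<close>)
    also have "\<dots> = (\<integral>\<^sup>+b. \<integral>\<^sup>+a. ennreal s * (ennreal s * \<Phi> \<tau> (s * a) (s * b)) \<partial>lborel \<partial>lborel)"
      by (subst nn_integral_cmult, (simp add: \<Phi>_def)+)+
    also have "\<dots> = (\<integral>\<^sup>+b. \<integral>\<^sup>+a. \<Psi> a b * (ennreal \<tau> * indicator {..1} (\<tau> * (1 + a\<^sup>2 + b\<^sup>2))) \<partial>lborel \<partial>lborel)"
    proof (intro nn_integral_cong)
      fix a b :: real
      have "ennreal s * ennreal s = ennreal \<tau>" using s by (simp add: ennreal_mult[symmetric] power2_eq_square)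
      then show "ennreal s * (ennreal s * \<Phi> \<tau> (s * a) (s * b)) = \<Psi> a b * (ennreal \<tau> * indicator {..1} (\<tau> * (1 + a\<^sup>2 + b\<^sup>2)))"
        unfolding \<Phi>s by (metis mult.assoc mult.commute)
    qed
    finally show ?thesis .
  qed
  \<comment> \<open>With \<open>l\<^sup>2 = 1 + a\<^sup>2 + b\<^sup>2\<close>, the N - 2 remaining
    coordinates contribute l^(-(N-2)) and the weight \<open>T\<close> contributes l^(-2). The total
    l^(-N) is the power that the disc integral takes with m = N.\<close>
  have K_scale: "(\<integral>\<^sup>+y. ennreal (T y) * indicator {..1} (T y * (1 + a\<^sup>2 + b\<^sup>2)) \<partial>RI)
      = K * ennreal ((1 + a\<^sup>2 + b\<^sup>2) powr (- real N / 2))" for a b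
  proof -
    define l where "l = sqrt (1 + a\<^sup>2 + b\<^sup>2)"
    have l: "l > 0" "1 + a\<^sup>2 + b\<^sup>2 = l\<^sup>2" using pos[of a b] by (simp_all add: l_def)
    have Tl: "T (\<lambda>i\<in>I. (1/l) * y i) = (1 / l\<^sup>2) * T y" for y
      by (simp add: T_def power_divide sum_divide_distrib)
    have "(\<integral>\<^sup>+y. ennreal (T y) * indicator {..1} (T y * (1 + a\<^sup>2 + b\<^sup>2)) \<partial>RI)
      = ennreal ((1/l) ^ card I) * (\<integral>\<^sup>+y. ennreal (1 / l\<^sup>2) * (ennreal (T y) * indicator {..1} (T y)) \<partial>RI)"
    proof (subst nn_integral_PiM_lborel_scale[OF finI, folded RI_def, where c="1/l"], goal_cases)
      case 3
      show ?case
        unfolding Tl l(2) using l(1) T_pos by (simp add: ennreal_mult[symmetric] mult.assoc[symmetric] divide_simps)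
    qed (use l in \<open>simp_all\<close>)
    also have "\<dots> = ennreal ((1/l) ^ card I) * (ennreal (1 / l\<^sup>2) * K)"
      unfolding K_def by (subst nn_integral_cmult) simp_all
    also have "\<dots> = ennreal ((1/l) ^ card I * (1 / l\<^sup>2)) * K"
      using l(1) by (subst ennreal_mult) (simp_all add: mult.assoc)
    also have "(1/l) ^ card I * (1 / l\<^sup>2) = (1/l) ^ N"
    proof -
      have "N - 2 + 2 = N" using N by simp
      then have "(1/l) ^ N = (1/l) ^ (N - 2) * (1/l)\<^sup>2" by (simp only: power_add[symmetric])
      then show ?thesis by (simp add: cardI power_one_over)
    qed
    also have "\<dots> = (1 + a\<^sup>2 + b\<^sup>2) powr (- real N / 2)"
      unfolding l(2) square_powr[OF l(1)] using l(1) by (simp add: powr_minus powr_realpow power_one_over inverse_eq_divide)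
    finally show ?thesis by (simp add: mult.commute)
  qed
  have "(\<integral>\<^sup>+x. f x \<partial>R) = (\<integral>\<^sup>+x. \<integral>\<^sup>+a. f (x(i := a)) \<partial>lborel \<partial>(\<Pi>\<^sub>M i\<in>insert j I. lborel))"
    unfolding R_def NI using finI iI by (intro product_nn_integral_insert) auto
  also have "\<dots> = (\<integral>\<^sup>+y. \<integral>\<^sup>+b. \<integral>\<^sup>+a. f (y(j := b, i := a)) \<partial>lborel \<partial>lborel \<partial>RI)"
    unfolding RI_def using finI iI jI by (intro product_nn_integral_insert) auto
  also have "\<dots> = (\<integral>\<^sup>+y. \<integral>\<^sup>+b. \<integral>\<^sup>+a. \<Phi> (T y) a b \<partial>lborel \<partial>lborel \<partial>RI)"
    unfolding f_upd ..
  also have "\<dots> = (\<integral>\<^sup>+y. \<integral>\<^sup>+b. \<integral>\<^sup>+a. \<Psi> a b * (ennreal (T y) * indicator {..1} (T y * (1 + a\<^sup>2 + b\<^sup>2))) \<partial>lborel \<partial>lborel \<partial>RI)"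
  \<comment> \<open>The rescaling requires \<open>T y > 0\<close>, which holds for almost every
    \<open>y\<close> because \<open>3 \<le> N\<close> leaves a coordinate in
    \<open>I\<close>.\<close>
  proof (rule nn_integral_cong_AE)
    have "I \<noteq> {}" using N cardI by auto
    from AE_PiM_lborel_sum_squares_pos[OF finI this]
    show "AE y in RI. (\<integral>\<^sup>+b. \<integral>\<^sup>+a. \<Phi> (T y) a b \<partial>lborel \<partial>lborel) =
       (\<integral>\<^sup>+b. \<integral>\<^sup>+a. \<Psi> a b * (ennreal (T y) * indicator {..1} (T y * (1 + a\<^sup>2 + b\<^sup>2))) \<partial>lborel \<partial>lborel)"
      unfolding RI_def T_def by eventually_elim (rule scale2[unfolded T_def])
  qed
  also have "\<dots> = (\<integral>\<^sup>+b. \<integral>\<^sup>+y. \<integral>\<^sup>+a. \<Psi> a b * (ennreal (T y) * indicator {..1} (T y * (1 + a\<^sup>2 + b\<^sup>2))) \<partial>lborel \<partial>RI \<partial>lborel)"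
    by (rule RL.Fubini'[symmetric]) (simp add: \<Psi>_def)
  also have "\<dots> = (\<integral>\<^sup>+b. \<integral>\<^sup>+a. \<integral>\<^sup>+y. \<Psi> a b * (ennreal (T y) * indicator {..1} (T y * (1 + a\<^sup>2 + b\<^sup>2))) \<partial>RI \<partial>lborel \<partial>lborel)"
    by (intro nn_integral_cong RL.Fubini'[symmetric]) (simp add: \<Psi>_def)
  also have "\<dots> = (\<integral>\<^sup>+b. \<integral>\<^sup>+a. K * (\<Psi> a b * ennreal ((1 + a\<^sup>2 + b\<^sup>2) powr (- real N / 2))) \<partial>lborel \<partial>lborel)"
    by (intro nn_integral_cong, subst nn_integral_cmult) (simp_all add: K_scale mult_ac)
  also have "\<dots> = K * (\<integral>\<^sup>+b. \<integral>\<^sup>+a. \<Psi> a b * ennreal ((1 + a\<^sup>2 + b\<^sup>2) powr (- real N / 2)) \<partial>lborel \<partial>lborel)"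
    by (subst nn_integral_cmult, (simp add: \<Psi>_def)+)+
  finally show ?thesis
    unfolding \<Psi>_def nn_integral_gnomonic_disc[OF assms(1)] K_def f_def T_def RI_def .
qed

section \<open>The planar Gaussian and the density of a coordinate pair relative to it\<close>

definition gauss2 :: "(real \<times> real) measure" where
  "gauss2 = maxwellian \<Otimes>\<^sub>M maxwellian"

abbreviation norm_sq :: "real \<times> real \<Rightarrow> real" where
  "norm_sq z \<equiv> (fst z)\<^sup>2 + (snd z)\<^sup>2"

lemma sets_maxwellian [measurable_cong, simp]: "sets maxwellian = sets borel"
  by (simp add: maxwellian_def)

lemma space_maxwellian [simp]: "space maxwellian = UNIV"
  by (simp add: maxwellian_def)

lemma sets_gauss2 [measurable_cong, simp]: "sets gauss2 = sets borel"
  unfolding gauss2_def borel_prod[symmetric] by (intro sets_pair_measure_cong) simp_all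

lemma space_gauss2 [simp]: "space gauss2 = UNIV"
  using sets_eq_imp_space_eq[OF sets_gauss2] by simp

lemma norm_sq_measurable [measurable]: "(\<lambda>z :: real \<times> real. norm_sq z) \<in> borel_measurable borel"
  unfolding borel_prod[symmetric] by measurable

lemma prob_space_maxwellian: "prob_space maxwellian"
  unfolding maxwellian_def by (rule prob_space_normal_density) simp

interpretation maxwellian: prob_space maxwellian
  by (rule prob_space_maxwellian)

interpretation maxwellian2: pair_prob_space maxwellian maxwellian ..

interpretation gauss2: prob_space gauss2
  unfolding gauss2_def by (rule maxwellian2.prob_space_axioms)

lemma std_normal_density_mult:
  "std_normal_density v * std_normal_density w = exp (- (v\<^sup>2 + w\<^sup>2) / 2) / (2 * pi)"
proof -
  have "std_normal_density v * std_normal_density w = 1 / (sqrt (2 * pi) * sqrt (2 * pi)) * (exp (- v\<^sup>2 / 2) * exp (- w\<^sup>2 / 2))"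
    by (simp add: std_normal_density_def)
  also have "sqrt (2 * pi) * sqrt (2 * pi) = 2 * pi" by simp
  also have "exp (- v\<^sup>2 / 2) * exp (- w\<^sup>2 / 2) = exp (- (v\<^sup>2 + w\<^sup>2) / 2)"
    by (subst exp_add[symmetric]) (simp add: add_divide_distrib)
  finally show ?thesis by simp
qed

lemma gauss2_density: "gauss2 = density lborel (\<lambda>z. ennreal (exp (- norm_sq z / 2) / (2 * pi)))"
proof -
  have "gauss2 = density (lborel \<Otimes>\<^sub>M lborel) (\<lambda>(v, w). ennreal (std_normal_density v) * ennreal (std_normal_density w))"
    unfolding gauss2_def maxwellian_def
    by (rule pair_measure_density) (use maxwellian.sigma_finite_measure_axioms in \<open>auto simp: maxwellian_def intro: lborel.sigma_finite_measure_axioms\<close>)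
  also have "\<dots> = density lborel (\<lambda>z. ennreal (exp (- norm_sq z / 2) / (2 * pi)))"
    unfolding lborel_prod
  proof (rule density_cong)
    show "AE z in lborel. (case z of (v, w) \<Rightarrow> ennreal (std_normal_density v) * ennreal (std_normal_density w)) = ennreal (exp (- norm_sq z / 2) / (2 * pi))"
    proof (rule AE_I2)
      fix z :: "real \<times> real"
      show "(case z of (v, w) \<Rightarrow> ennreal (std_normal_density v) * ennreal (std_normal_density w)) = ennreal (exp (- norm_sq z / 2) / (2 * pi))"
        by (cases z) (simp add: ennreal_mult[symmetric] std_normal_density_mult)
    qed
  qed (auto simp: borel_prod[symmetric] split_beta)
  finally show ?thesis .
qed

lemma nn_integral_gauss2:
  assumes [measurable]: "F \<in> borel_measurable borel"
  shows "(\<integral>\<^sup>+z. F z \<partial>gauss2) = (\<integral>\<^sup>+v. \<integral>\<^sup>+w. F (v, w) * ennreal (exp (- (v\<^sup>2 + w\<^sup>2) / 2) / (2 * pi)) \<partial>lborel \<partial>lborel)"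
proof -
  have [measurable]: "F \<in> borel_measurable (lborel \<Otimes>\<^sub>M lborel)"
    using assms by (simp add: lborel_prod)
  have "(\<integral>\<^sup>+z. F z \<partial>gauss2) = (\<integral>\<^sup>+z. ennreal (exp (- norm_sq z / 2) / (2 * pi)) * F z \<partial>lborel)"
    unfolding gauss2_density by (subst nn_integral_density) (auto simp: borel_prod[symmetric])
  also have "\<dots> = (\<integral>\<^sup>+z. F z * ennreal (exp (- norm_sq z / 2) / (2 * pi)) \<partial>(lborel \<Otimes>\<^sub>M lborel))"
    unfolding lborel_prod by (simp only: mult.commute)
  also have "\<dots> = (\<integral>\<^sup>+v. \<integral>\<^sup>+w. F (v, w) * ennreal (exp (- (v\<^sup>2 + w\<^sup>2) / 2) / (2 * pi)) \<partial>lborel \<partial>lborel)"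
    by (subst lborel.nn_integral_fst[symmetric]) simp_all
  finally show ?thesis .
qed

text \<open>
  Up to the normalization \<open>pair_mass N\<close>, the density of two coordinates on the sphere relative
  to the Gaussian, at squared norm \<open>x\<close>.
\<close>

definition pair_ratio :: "nat \<Rightarrow> real \<Rightarrow> real" where
  "pair_ratio N x = max 0 (1 - x / real N) powr ((real N - 4) / 2) * exp (x / 2)"

definition pair_mass :: "nat \<Rightarrow> real" where
  "pair_mass N = (\<integral>z. pair_ratio N (norm_sq z) \<partial>gauss2)"

lemma pair_ratio_measurable [measurable]: "pair_ratio N \<in> borel_measurable borel"
  unfolding pair_ratio_def[abs_def] by measurable

lemma pair_ratio_nonneg: "0 \<le> pair_ratio N x"
  by (simp add: pair_ratio_def)

text \<open>From \<open>1 - y \<le> exp (- y)\<close> with \<open>y = x / N\<close> and a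
  nonnegative exponent, the quotient is at most \<open>exp (2 * x / N)\<close>; it vanishes unless
  \<open>x < N\<close>, whence \<open>exp 2\<close>. Being uniform in N, the bound serves as
  domination in the limits of pair expectations.\<close>

lemma pair_ratio_le:
  assumes "4 \<le> N" "0 \<le> x"
  shows "pair_ratio N x \<le> exp 2"
proof (cases "x < real N")
  case False
  then have "max 0 (1 - x / real N) = 0" using assms by (simp add: field_simps)
  then show ?thesis by (simp add: pair_ratio_def)
next
  case True
  have N: "real N \<ge> 4" using assms(1) by simp
  have "max 0 (1 - x / real N) = 1 - x / real N" using True N by (simp add: field_simps)
  moreover have "(1 - x / real N) powr ((real N - 4) / 2) \<le> exp (- x / real N) powr ((real N - 4) / 2)"
    using exp_ge_add_one_self[of "- x / real N"] True N by (intro powr_mono2) (auto simp: field_simps)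
  moreover have "exp (- x / real N) powr ((real N - 4) / 2) * exp (x / 2) = exp (2 * (x / real N))"
    using N by (simp add: exp_powr_real exp_add[symmetric] field_simps)
  moreover have "exp (2 * (x / real N)) \<le> exp 2" using True N by (simp add: field_simps)
  ultimately show ?thesis
    unfolding pair_ratio_def by (smt (verit) exp_gt_zero mult_right_mono)
qed

section \<open>The two-coordinate marginal of the sphere measure\<close>

text \<open>The ball lies between the cubes of half-side 1/N and 1. Only positivity and finiteness
  of its volume matter, so that \<open>uniform_measure\<close> is a probability; the value is never
  computed.\<close>

lemma emeasure_ball_PiM_lborel:
  fixes N :: nat
  defines "R \<equiv> (\<Pi>\<^sub>M i\<in>{..<N}. lborel :: real measure)"
  shows "emeasure R {x \<in> space R. (\<Sum>k<N. (x k)\<^sup>2) \<le> 1} \<noteq> 0"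
    and "emeasure R {x \<in> space R. (\<Sum>k<N. (x k)\<^sup>2) \<le> 1} \<noteq> \<infinity>"
proof -
  interpret product_sigma_finite "\<lambda>_. lborel :: real measure" by standard
  let ?B = "{x \<in> space R. (\<Sum>k<N. (x k)\<^sup>2) \<le> 1}"
  have [measurable]: "(\<lambda>x. \<Sum>k<N. (x k)\<^sup>2) \<in> borel_measurable R"
    using measurable_component_singleton[of _ "{..<N}" "\<lambda>_. lborel :: real measure"]
    by (intro borel_measurable_sum borel_measurable_power) (auto simp: R_def)
  have B: "?B \<in> sets R" by measurable
  have cube: "emeasure R (\<Pi>\<^sub>E i\<in>{..<N}. {-c..c}) = ennreal ((2 * c) ^ N)" if "c \<ge> 0" for c
    unfolding R_def using that by (subst emeasure_PiM) (auto simp: ennreal_power)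
  have cs: "(\<Pi>\<^sub>E i\<in>{..<N}. {-c..c}) \<in> sets R" for c :: real
    unfolding R_def by (intro sets_PiM_I_finite) auto
  have "?B \<subseteq> (\<Pi>\<^sub>E i\<in>{..<N}. {-1..1})"
  proof
    fix x assume x: "x \<in> ?B"
    have "(x k)\<^sup>2 \<le> 1" if "k < N" for k
      using x that member_le_sum[of k "{..<N}" "\<lambda>k. (x k)\<^sup>2"] by auto
    then have "\<bar>x k\<bar> \<le> 1" if "k < N" for k
      using that by (simp add: abs_square_le_1)
    then show "x \<in> (\<Pi>\<^sub>E i\<in>{..<N}. {-1..1})"
      using x by (auto simp: R_def space_PiM PiE_iff abs_le_iff)
  qed
  then have "emeasure R ?B \<le> ennreal ((2 * 1) ^ N)"
    using emeasure_mono[OF _ cs[of 1]] cube[of 1] by simp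
  then show "emeasure R ?B \<noteq> \<infinity>" by (auto simp: top_unique)
  have "(\<Pi>\<^sub>E i\<in>{..<N}. {- (1 / real N)..1 / real N}) \<subseteq> ?B"
  proof
    fix x assume x: "x \<in> (\<Pi>\<^sub>E i\<in>{..<N}. {- (1 / real N)..1 / real N})"
    have "(x k)\<^sup>2 \<le> (1 / real N)\<^sup>2" if "k < N" for k
    proof -
      have "x k \<in> {- (1 / real N)..1 / real N}" using x that by (auto simp: PiE_iff)
      then show ?thesis by (intro abs_le_square_iff[THEN iffD1]) (auto simp: abs_le_iff)
    qed
    then have "(\<Sum>k<N. (x k)\<^sup>2) \<le> (\<Sum>k<N. (1 / real N)\<^sup>2)" by (intro sum_mono) auto
    also have "\<dots> \<le> 1" by (cases "N = 0") (auto simp: power2_eq_square field_simps)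
    finally show "x \<in> ?B" using x by (auto simp: R_def space_PiM PiE_iff)
  qed
  from emeasure_mono[OF this B] have "ennreal ((2 * (1 / real N)) ^ N) \<le> emeasure R ?B"
    using cube[of "1 / real N"] by simp
  \<comment> \<open>For \<open>N = 0\<close> the side is \<open>1 / 0 = 0\<close>, but its zeroth
    power is 1, so the lower bound stays positive.\<close>
  moreover have "ennreal ((2 * (1 / real N)) ^ N) > 0"
    by (cases "N = 0") (auto simp: ennreal_zero_less_one)
  ultimately show "emeasure R ?B \<noteq> 0" by auto
qed

lemma sets_sphere_measure [simp, measurable_cong]:
  "sets (sphere_measure N) = sets (\<Pi>\<^sub>M i\<in>{..<N}. borel)"
  by (simp add: sphere_measure_def Let_def)

lemma sphere_projection_measurable [measurable]:
  "(\<lambda>x. \<lambda>i\<in>{..<N}. sqrt (real N) * x i / sqrt (\<Sum>k<N. (x k)\<^sup>2)) \<in> (\<Pi>\<^sub>M i\<in>{..<N}. lborel) \<rightarrow>\<^sub>M (\<Pi>\<^sub>M i\<in>{..<N}. borel)"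
proof (rule measurable_restrict)
  fix i assume "i \<in> {..<N}"
  then have [measurable]: "(\<lambda>x. x i) \<in> borel_measurable (\<Pi>\<^sub>M i\<in>{..<N}. lborel :: real measure)"
    using measurable_component_singleton[of i "{..<N}" "\<lambda>_. lborel :: real measure"] by auto
  have [measurable]: "(\<lambda>x. \<Sum>k<N. (x k)\<^sup>2) \<in> borel_measurable (\<Pi>\<^sub>M i\<in>{..<N}. lborel :: real measure)"
    using measurable_component_singleton[of _ "{..<N}" "\<lambda>_. lborel :: real measure"]
    by (intro borel_measurable_sum borel_measurable_power) auto
  show "(\<lambda>x. sqrt (real N) * x i / sqrt (\<Sum>k<N. (x k)\<^sup>2)) \<in> borel_measurable (\<Pi>\<^sub>M i\<in>{..<N}. lborel)"
    by measurable
qed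

lemma prob_space_sphere_measure: "prob_space (sphere_measure N)"
  unfolding sphere_measure_def Let_def
  using emeasure_ball_PiM_lborel[of N]
  by (intro prob_space.prob_space_distr prob_space_uniform_measure)
    (auto simp: measurable_cong_sets[OF sets_uniform_measure refl] intro: sphere_projection_measurable)

lemma sphere_coordinate_pair_measurable:
  assumes "i < N" "j < N"
  shows "(\<lambda>v. (v i, v j)) \<in> sphere_measure N \<rightarrow>\<^sub>M borel"
  unfolding borel_prod[symmetric] using assms
  by (intro measurable_Pair) (auto intro!: measurable_component_singleton simp: cong: measurable_cong_sets)

text \<open>The constant hides the volume of the ball and the integral over the other coordinates,
  and it does not depend on \<open>H\<close>. Testing with the constant function 1 identifies it
  afterwards, so neither quantity has to be evaluated.\<close>

lemma nn_integral_sphere_pair: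
  fixes N i j :: nat
  assumes ij: "i < N" "j < N" "i \<noteq> j" and N: "3 \<le> N"
  shows "\<exists>c. \<forall>H \<in> borel_measurable borel.
    (\<integral>\<^sup>+v. H (v i, v j) \<partial>sphere_measure N) = c * (\<integral>\<^sup>+z. H z * ennreal (pair_ratio N (norm_sq z)) \<partial>gauss2)"
proof -
  define R where "R = (\<Pi>\<^sub>M i\<in>{..<N}. lborel :: real measure)"
  define B where "B = {x \<in> space R. (\<Sum>k<N. (x k)\<^sup>2) \<le> 1}"
  define K where "K = (\<integral>\<^sup>+y. ennreal (\<Sum>k\<in>{..<N}-{i,j}. (y k)\<^sup>2) * indicator {..1} (\<Sum>k\<in>{..<N}-{i,j}. (y k)\<^sup>2) \<partial>(\<Pi>\<^sub>M i\<in>{..<N}-{i,j}. lborel :: real measure))"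
  define r where "r = sqrt (real N)"
  have r: "r > 0" "r\<^sup>2 = real N" using N by (simp_all add: r_def)
  have [measurable]: "(\<lambda>x. \<Sum>k<N. (x k)\<^sup>2) \<in> borel_measurable R"
    using measurable_component_singleton[of _ "{..<N}" "\<lambda>_. lborel :: real measure"]
    by (intro borel_measurable_sum borel_measurable_power) (auto simp: R_def)
  have [measurable]: "(\<lambda>x. x i) \<in> borel_measurable R" "(\<lambda>x. x j) \<in> borel_measurable R"
    using ij measurable_component_singleton[of _ "{..<N}" "\<lambda>_. lborel :: real measure"] by (auto simp: R_def)
  have Bs: "B \<in> sets R" unfolding B_def by measurable
  have "(\<integral>\<^sup>+v. H (v i, v j) \<partial>sphere_measure N)
     = (K * ennreal (2 * pi / N) / emeasure R B) * (\<integral>\<^sup>+z. H z * ennreal (pair_ratio N (norm_sq z)) \<partial>gauss2)"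
    if H[measurable]: "H \<in> borel_measurable borel" for H :: "real \<times> real \<Rightarrow> ennreal"
  proof -
    have H'[measurable]: "H \<in> borel_measurable (lborel \<Otimes>\<^sub>M lborel)" "H \<in> borel_measurable (borel \<Otimes>\<^sub>M borel)"
      using H by (simp_all add: borel_prod lborel_prod)
    define G where "G z = H (r * fst z, r * snd z)" for z
    have [measurable]: "G \<in> borel_measurable borel"
      unfolding G_def[abs_def] borel_prod[symmetric] by measurable
    define J where "J = (\<integral>\<^sup>+p. \<integral>\<^sup>+q. H (p, q) * ennreal (max 0 (1 - (p\<^sup>2 + q\<^sup>2) / N) powr ((real N - 4) / 2)) \<partial>lborel \<partial>lborel)"
    have "(\<integral>\<^sup>+v. H (v i, v j) \<partial>sphere_measure N)
      = (\<integral>\<^sup>+x. H (r * x i / sqrt (\<Sum>k<N. (x k)\<^sup>2), r * x j / sqrt (\<Sum>k<N. (x k)\<^sup>2)) \<partial>uniform_measure R B)"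
      unfolding sphere_measure_def Let_def R_def[symmetric] B_def[symmetric]
      using sphere_projection_measurable[of N] ij
      by (subst nn_integral_distr)
        (auto simp: R_def[symmetric] r_def measurable_cong_sets[OF sets_uniform_measure refl] intro!: measurable_compose[OF _ H]
          sphere_coordinate_pair_measurable[unfolded measurable_cong_sets[OF sets_sphere_measure refl]])
    also have "\<dots> = (\<integral>\<^sup>+x. G (x i / sqrt (\<Sum>k<N. (x k)\<^sup>2), x j / sqrt (\<Sum>k<N. (x k)\<^sup>2)) * indicator {..1} (\<Sum>k<N. (x k)\<^sup>2) \<partial>R) / emeasure R B"
      using Bs by (subst nn_integral_uniform_measure)
        (auto simp: G_def B_def intro!: arg_cong2[where f="(/)"] nn_integral_cong split: split_indicator)
    also have "\<dots> = K * (\<integral>\<^sup>+p. \<integral>\<^sup>+q. H (r * p, r * q) * ennreal (max 0 (1 - p\<^sup>2 - q\<^sup>2) powr ((real N - 4) / 2)) \<partial>lborel \<partial>lborel) / emeasure R B"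
      unfolding R_def by (subst nn_integral_ball_two_coordinates[OF _ ij N]) (simp_all add: K_def G_def)
    \<comment> \<open>The sphere has radius \<open>sqrt N\<close>: scaling both coordinates by it
      produces the factor 1/N.\<close>
    also have "(\<integral>\<^sup>+p. \<integral>\<^sup>+q. H (r * p, r * q) * ennreal (max 0 (1 - p\<^sup>2 - q\<^sup>2) powr ((real N - 4) / 2)) \<partial>lborel \<partial>lborel) = ennreal (1 / N) * J"
    proof -
      have e: "1 - ((r * p)\<^sup>2 + (r * q)\<^sup>2) / N = 1 - p\<^sup>2 - q\<^sup>2" for p q
        using r N by (simp add: power_mult_distrib field_simps)
      have "J = ennreal r * (\<integral>\<^sup>+p. \<integral>\<^sup>+q. H (r * p, q) * ennreal (max 0 (1 - ((r * p)\<^sup>2 + q\<^sup>2) / N) powr ((real N - 4) / 2)) \<partial>lborel \<partial>lborel)"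
        unfolding J_def
      proof (subst nn_integral_real_affine[where c=r and t=0], goal_cases)
        case 3 show ?case using r(1) by simp
      qed (use r in auto)
      also have "\<dots> = ennreal r * (\<integral>\<^sup>+p. ennreal r * (\<integral>\<^sup>+q. H (r * p, r * q) * ennreal (max 0 (1 - ((r * p)\<^sup>2 + (r * q)\<^sup>2) / N) powr ((real N - 4) / 2)) \<partial>lborel) \<partial>lborel)"
        by (intro arg_cong2[where f="(*)"] refl nn_integral_cong, subst nn_integral_real_affine[where c=r and t=0])
          (use r in auto)
      also have "\<dots> = ennreal r * (ennreal r * (\<integral>\<^sup>+p. \<integral>\<^sup>+q. H (r * p, r * q) * ennreal (max 0 (1 - p\<^sup>2 - q\<^sup>2) powr ((real N - 4) / 2)) \<partial>lborel \<partial>lborel))"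
        unfolding e by (subst nn_integral_cmult) simp_all
      finally show ?thesis
        using r N by (simp add: mult.assoc[symmetric] ennreal_mult[symmetric] power2_eq_square)
    qed
    also have "J = ennreal (2 * pi) * (\<integral>\<^sup>+z. H z * ennreal (pair_ratio N (norm_sq z)) \<partial>gauss2)"
    proof -
      have [measurable]: "(\<lambda>z. H z * ennreal (pair_ratio N (norm_sq z))) \<in> borel_measurable borel"
        unfolding borel_prod[symmetric] by measurable
      have c: "pair_ratio N (v\<^sup>2 + w\<^sup>2) * (exp (- (v\<^sup>2 + w\<^sup>2) / 2) / (2 * pi))
         = (1 / (2 * pi)) * max 0 (1 - (v\<^sup>2 + w\<^sup>2) / N) powr ((real N - 4) / 2)" for v w
      proof -
        have "exp ((v\<^sup>2 + w\<^sup>2) / 2) * exp (- (v\<^sup>2 + w\<^sup>2) / 2) = 1"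
          by (subst exp_add[symmetric]) (simp add: field_simps)
        then show ?thesis by (simp add: pair_ratio_def)
      qed
      have "(\<integral>\<^sup>+z. H z * ennreal (pair_ratio N (norm_sq z)) \<partial>gauss2)
        = (\<integral>\<^sup>+v. \<integral>\<^sup>+w. ennreal (1 / (2 * pi)) * (H (v, w) * ennreal (max 0 (1 - (v\<^sup>2 + w\<^sup>2) / N) powr ((real N - 4) / 2))) \<partial>lborel \<partial>lborel)"
      proof (subst nn_integral_gauss2, measurable, intro nn_integral_cong)
        fix v w :: real
        have "ennreal (pair_ratio N (v\<^sup>2 + w\<^sup>2)) * ennreal (exp (- (v\<^sup>2 + w\<^sup>2) / 2) / (2 * pi))
          = ennreal (1 / (2 * pi)) * ennreal (max 0 (1 - (v\<^sup>2 + w\<^sup>2) / N) powr ((real N - 4) / 2))"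
          unfolding ennreal_mult[OF pair_ratio_nonneg, symmetric, OF divide_nonneg_pos[OF exp_ge_zero], OF mult_pos_pos[OF zero_less_numeral pi_gt_zero]] c
          by (rule ennreal_mult) auto
        then show "H (v, w) * ennreal (pair_ratio N (norm_sq (v, w))) * ennreal (exp (- (v\<^sup>2 + w\<^sup>2) / 2) / (2 * pi))
          = ennreal (1 / (2 * pi)) * (H (v, w) * ennreal (max 0 (1 - (v\<^sup>2 + w\<^sup>2) / N) powr ((real N - 4) / 2)))"
          by (simp only: mult.assoc fst_conv snd_conv) (rule mult.left_commute)
      qed
      also have "\<dots> = ennreal (1 / (2 * pi)) * J"
        unfolding J_def by (subst nn_integral_cmult, simp)+ simp
      finally show ?thesis by (simp add: mult.assoc[symmetric] ennreal_mult[symmetric])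
    qed
    finally have "(\<integral>\<^sup>+v. H (v i, v j) \<partial>sphere_measure N)
      = K * (ennreal (1 / N) * (ennreal (2 * pi) * (\<integral>\<^sup>+z. H z * ennreal (pair_ratio N (norm_sq z)) \<partial>gauss2))) / emeasure R B" .
    moreover have "ennreal (2 * pi / N) = ennreal (1 / N) * ennreal (2 * pi)"
      by (subst ennreal_mult[symmetric]) simp_all
    ultimately show ?thesis by (simp only: divide_ennreal_def mult_ac)
  qed
  then show ?thesis by blast
qed

lemma integrable_pair_ratio:
  assumes "4 \<le> N"
  shows "integrable gauss2 (\<lambda>z. pair_ratio N (norm_sq z))"
  using assms by (intro gauss2.integrable_const_bound[where B="exp 2"])
    (auto simp: pair_ratio_nonneg pair_ratio_le borel_prod[symmetric])

text \<open>The marginal has total mass 1, which forces \<open>c * pair_mass N = 1\<close>. This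
  determines the unknown constant and at the same time excludes a vanishing normalization.\<close>

lemma distr_sphere_pair:
  fixes N i j :: nat
  assumes ij: "i < N" "j < N" "i \<noteq> j" and N: "4 \<le> N"
  shows "0 < pair_mass N"
    and "distr (sphere_measure N) borel (\<lambda>v. (v i, v j)) = density gauss2 (\<lambda>z. ennreal (pair_ratio N (norm_sq z) / pair_mass N))"
proof -
  interpret S: prob_space "sphere_measure N" by (rule prob_space_sphere_measure)
  obtain c where c: "\<And>H. H \<in> borel_measurable borel \<Longrightarrow>
    (\<integral>\<^sup>+v. H (v i, v j) \<partial>sphere_measure N) = c * (\<integral>\<^sup>+z. H z * ennreal (pair_ratio N (norm_sq z)) \<partial>gauss2)"
    using nn_integral_sphere_pair[OF ij] N by auto
  have m[measurable]: "(\<lambda>z. pair_ratio N (norm_sq z)) \<in> borel_measurable borel"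
    unfolding borel_prod[symmetric] by measurable
  have pm: "(\<integral>\<^sup>+z. ennreal (pair_ratio N (norm_sq z)) \<partial>gauss2) = ennreal (pair_mass N)"
    unfolding pair_mass_def using integrable_pair_ratio[OF N] by (intro nn_integral_eq_integral) (auto simp: pair_ratio_nonneg)
  have c1: "c * ennreal (pair_mass N) = 1"
    using c[of "\<lambda>_. 1"] S.emeasure_space_1 by (simp add: pm)
  have nn: "0 \<le> pair_mass N" unfolding pair_mass_def by (simp add: pair_ratio_nonneg)
  show pos: "0 < pair_mass N"
    using c1 nn by (cases "pair_mass N = 0") auto
  have ceq: "c = ennreal (1 / pair_mass N)"
  proof -
    have "c = c * (ennreal (pair_mass N) * ennreal (1 / pair_mass N))"
      using pos by (simp add: ennreal_mult[symmetric])
    also have "\<dots> = ennreal (1 / pair_mass N)" using c1 by (simp add: mult.assoc[symmetric])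
    finally show ?thesis .
  qed
  show "distr (sphere_measure N) borel (\<lambda>v. (v i, v j)) = density gauss2 (\<lambda>z. ennreal (pair_ratio N (norm_sq z) / pair_mass N))"
  proof (rule measure_eqI)
    fix A assume "A \<in> sets (distr (sphere_measure N) borel (\<lambda>v. (v i, v j)))"
    then have A[measurable]: "A \<in> sets borel" by simp
    have "emeasure (distr (sphere_measure N) borel (\<lambda>v. (v i, v j))) A = (\<integral>\<^sup>+v. indicator A (v i, v j) \<partial>sphere_measure N)"
      using sphere_coordinate_pair_measurable[OF ij(1,2)]
      by (subst nn_integral_indicator[symmetric]) (simp, subst nn_integral_distr, auto)
    also have "\<dots> = ennreal (1 / pair_mass N) * (\<integral>\<^sup>+z. indicator A z * ennreal (pair_ratio N (norm_sq z)) \<partial>gauss2)"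
      by (subst c) (simp_all add: ceq)
    also have "\<dots> = (\<integral>\<^sup>+z. ennreal (pair_ratio N (norm_sq z) / pair_mass N) * indicator A z \<partial>gauss2)"
      using pos by (subst nn_integral_cmult[symmetric])
        (auto intro!: nn_integral_cong simp: ennreal_mult[symmetric] pair_ratio_nonneg split: split_indicator)
    also have "\<dots> = emeasure (density gauss2 (\<lambda>z. ennreal (pair_ratio N (norm_sq z) / pair_mass N))) A"
      by (subst emeasure_density) auto
    finally show "emeasure (distr (sphere_measure N) borel (\<lambda>v. (v i, v j))) A
      = emeasure (density gauss2 (\<lambda>z. ennreal (pair_ratio N (norm_sq z) / pair_mass N))) A" .
  qed simp
qed

section \<open>Comparison with the Gaussian\<close>

text \<open>Once N exceeds \<open>x\<close> the truncation is inactive, and writing the power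
  through \<open>ln\<close> gives the form suited to asymptotic expansion.\<close>

lemma eventually_pair_ratio_eq:
  assumes "0 < x"
  shows "eventually (\<lambda>N. pair_ratio N x = exp ((real N - 4) / 2 * ln (1 - x / real N) + x / 2)) sequentially"
  using eventually_gt_at_top[of "nat \<lceil>x\<rceil>"]
proof eventually_elim
  case (elim N)
  then have "x < real N" by linarith
  then have "1 - x / real N > 0" using assms by simp
  moreover from this have "max 0 (1 - x / real N) = 1 - x / real N" by simp
  moreover have "y powr a = exp (a * ln y)" if "0 < y" for y a :: real using that by (simp add: powr_def)
  ultimately show ?case unfolding pair_ratio_def exp_add by (simp only:)
qed

lemma pair_ratio_0: "0 < N \<Longrightarrow> pair_ratio N 0 = 1"
  by (simp add: pair_ratio_def)

lemma pair_ratio_tendsto: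
  assumes "0 \<le> x"
  shows "(\<lambda>N. pair_ratio N x) \<longlonglongrightarrow> 1"
proof (cases "x = 0")
  case True
  have "eventually (\<lambda>N. pair_ratio N 0 = 1) sequentially"
    using eventually_gt_at_top[of 0] by eventually_elim (rule pair_ratio_0)
  then show ?thesis using True by (simp add: tendsto_eventually)
next
  case False
  then have "0 < x" using assms by simp
  then have "(\<lambda>N. exp ((real N - 4) / 2 * ln (1 - x / real N) + x / 2)) \<longlonglongrightarrow> 1"
    by real_asymp
  then show ?thesis by (subst tendsto_cong[OF eventually_pair_ratio_eq[OF \<open>0 < x\<close>]])
qed

text \<open>The logarithm \<open>L N\<close> of the quotient is (2x - x^2/4)/N to first order: 2x
  comes from the -4 in the exponent, and -x^2/4 from the quadratic term of
  \<open>ln (1 - x / N)\<close>. The inequalities \<open>L \<le> exp L - 1 \<le> L * exp L\<close>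
  pass from the logarithm to the quotient.\<close>

lemma pair_ratio_first_order:
  assumes "0 \<le> x"
  shows "(\<lambda>N. real N * (pair_ratio N x - 1)) \<longlonglongrightarrow> 2 * x - x\<^sup>2 / 4"
proof (cases "x = 0")
  case True
  have "eventually (\<lambda>N. real N * (pair_ratio N 0 - 1) = 0) sequentially"
    using eventually_gt_at_top[of 0] by eventually_elim (simp add: pair_ratio_0)
  then show ?thesis using True by (simp add: tendsto_eventually)
next
  case False
  then have x: "0 < x" using assms by simp
  define L where "L N = (real N - 4) / 2 * ln (1 - x / real N) + x / 2" for N
  have E: "(\<lambda>N. exp (L N)) \<longlonglongrightarrow> 1" unfolding L_def using x by real_asymp
  have NL: "(\<lambda>N. real N * L N) \<longlonglongrightarrow> 2 * x - x\<^sup>2 / 4"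
    unfolding L_def using x by real_asymp (simp add: field_simps power2_eq_square)
  have "(\<lambda>N. real N * (exp (L N) - 1)) \<longlonglongrightarrow> 2 * x - x\<^sup>2 / 4"
  proof (rule tendsto_sandwich)
    show "(\<lambda>N. real N * L N) \<longlonglongrightarrow> 2 * x - x\<^sup>2 / 4" by (rule NL)
    show "(\<lambda>N. real N * L N * exp (L N)) \<longlonglongrightarrow> 2 * x - x\<^sup>2 / 4"
      using tendsto_mult[OF NL E] by simp
    have "L N \<le> exp (L N) - 1" for N using exp_ge_add_one_self[of "L N"] by linarith
    then show "eventually (\<lambda>N. real N * L N \<le> real N * (exp (L N) - 1)) sequentially"
      by (intro always_eventually allI mult_left_mono) auto
    have "exp (L N) - 1 \<le> L N * exp (L N)" for N using exp_ge_add_one_self[of "- L N"]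
      by (simp add: exp_minus field_simps)
    then show "eventually (\<lambda>N. real N * (exp (L N) - 1) \<le> real N * L N * exp (L N)) sequentially"
      unfolding mult.assoc by (intro always_eventually allI mult_left_mono) auto
  qed
  moreover have "eventually (\<lambda>N. real N * (pair_ratio N x - 1) = real N * (exp (L N) - 1)) sequentially"
    using eventually_pair_ratio_eq[OF x] by eventually_elim (simp add: L_def)
  ultimately show ?thesis by (subst tendsto_cong)
qed

text \<open>Domination for the first-order expansion: a fixed polynomial in \<open>x\<close>, whose
  products with h(v) and with h(v) h(w) are Gaussian-integrable when \<open>h\<close> is square
  integrable.\<close>

lemma pair_ratio_first_order_le:
  assumes N: "4 \<le> N" and x: "0 \<le> x"
  shows "\<bar>real N * (pair_ratio N x - 1)\<bar> \<le> exp 2 * (2 * x + x\<^sup>2)"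
\<comment> \<open>If \<open>2 * x > N\<close>, the prefactor N is itself below \<open>2 * x\<close>
  and the crude bound on the quotient suffices. Otherwise \<open>x / N \<le> 1/2\<close>, where the
  logarithm is known up to a quadratic error.\<close>
proof (cases "2 * x \<le> real N")
  case False
  have "\<bar>pair_ratio N x - 1\<bar> \<le> exp 2"
    using pair_ratio_le[OF N x] pair_ratio_nonneg[of N x] by (auto simp: abs_le_iff intro: order_trans[of _ 1])
  then have "real N * \<bar>pair_ratio N x - 1\<bar> \<le> (2 * x) * exp 2"
    using False by (intro mult_mono) auto
  also have "\<dots> \<le> exp 2 * (2 * x + x\<^sup>2)" by (simp add: algebra_simps)
  finally show ?thesis by (simp add: abs_mult)
next
  case True
  define n where "n = real N"
  define z where "z = x / n"
  define L where "L = (n - 4) / 2 * ln (1 - z) + x / 2"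
  have n: "n \<ge> 4" using N by (simp add: n_def)
  have z: "0 \<le> z" "z \<le> 1/2" and xz: "x = n * z"
    using x n True by (simp_all add: z_def field_simps n_def)
  have "pair_ratio N x = exp L"
    using z unfolding pair_ratio_def n_def[symmetric] z_def[symmetric] L_def by (simp add: exp_add powr_def)
  have up: "ln (1 - z) \<le> - z" using z ln_le_minus_one[of "1 - z"] by simp
  have lo: "- z - 2 * z\<^sup>2 \<le> ln (1 - z)" using z by (rule ln_one_minus_pos_lower_bound)
  have "L \<le> (n - 4) / 2 * (- z) + x / 2"
    unfolding L_def using up n by (intro add_right_mono mult_left_mono) auto
  also have "\<dots> = 2 * z" unfolding xz by (simp add: field_simps)
  finally have L1: "L \<le> 2 * z" .
  have "L \<ge> (n - 4) / 2 * (- z - 2 * z\<^sup>2) + x / 2"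
    unfolding L_def using lo n by (intro add_right_mono mult_left_mono) auto
  moreover have "(n - 4) / 2 * (- z - 2 * z\<^sup>2) + x / 2 = 2 * z + 4 * z\<^sup>2 - n * z\<^sup>2"
    unfolding xz by (simp add: field_simps)
  ultimately have L2: "- n * z\<^sup>2 \<le> L" using z by (smt (verit) mult_minus_left zero_le_power2)
  have absL: "\<bar>L\<bar> \<le> 2 * z + n * z\<^sup>2" 
  proof -
    have "0 \<le> n * z\<^sup>2" using n by simp
    then show ?thesis using L1 L2 z by (simp add: abs_le_iff)
  qed
  have "\<bar>exp L - 1\<bar> \<le> exp 2 * \<bar>L\<bar>"
  proof (cases "0 \<le> L")
    case True
    have "exp L - 1 \<le> exp L * L" using exp_ge_add_one_self[of "- L"]
      by (simp add: exp_minus field_simps)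
    also have "\<dots> \<le> exp 2 * L" using True L1 z by (intro mult_right_mono) auto
    finally show ?thesis using True by simp
  next
    case False
    have "1 - exp L \<le> - L" using exp_ge_add_one_self[of L] by linarith
    also have "\<dots> \<le> exp 2 * (- L)" using False by (simp add: mult_le_cancel_right1)
    finally show ?thesis using False by simp
  qed
  also have "\<dots> \<le> exp 2 * (2 * z + n * z\<^sup>2)" using absL by simp
  finally have "n * \<bar>exp L - 1\<bar> \<le> n * (exp 2 * (2 * z + n * z\<^sup>2))" using n by (intro mult_left_mono) auto
  also have "\<dots> = exp 2 * (2 * x + x\<^sup>2)" unfolding xz by (simp add: algebra_simps power2_eq_square)
  finally show ?thesis using \<open>pair_ratio N x = exp L\<close> by (simp add: abs_mult n_def)
qed

section \<open>Expectations of functions of a coordinate pair\<close>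

text \<open>No indices occur, since all pairs of distinct coordinates have the same law: for
  Gaussian-integrable \<open>F\<close> and \<open>4 \<le> N\<close> this is the sphere expectation
  of \<open>F (v i, v j)\<close>.\<close>

definition pair_expectation :: "nat \<Rightarrow> (real \<times> real \<Rightarrow> real) \<Rightarrow> real" where
  "pair_expectation N F = (\<integral>z. F z * pair_ratio N (norm_sq z) \<partial>gauss2) / pair_mass N"

lemma pair_ratio_norm_sq_measurable [measurable]:
  "(\<lambda>z. pair_ratio N (norm_sq z)) \<in> borel_measurable gauss2"
  using measurable_compose[OF norm_sq_measurable pair_ratio_measurable] by simp

lemma integrable_mult_pair_ratio:
  assumes "integrable gauss2 F" "4 \<le> N"
  shows "integrable gauss2 (\<lambda>z. F z * pair_ratio N (norm_sq z))"
proof (rule Bochner_Integration.integrable_bound)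
  show "integrable gauss2 (\<lambda>z. exp 2 * F z)" using assms by simp
  have [measurable]: "F \<in> borel_measurable gauss2" using assms(1) by simp
  show "(\<lambda>z. F z * pair_ratio N (norm_sq z)) \<in> borel_measurable gauss2" by measurable
  show "AE z in gauss2. norm (F z * pair_ratio N (norm_sq z)) \<le> norm (exp 2 * F z)"
    using pair_ratio_le[OF assms(2)] pair_ratio_nonneg
    by (auto simp: abs_mult mult.commute[of "exp 2"] intro!: mult_left_mono)
qed

lemma sphere_pair_integral:
  fixes F :: "real \<times> real \<Rightarrow> real"
  assumes "i < N" "j < N" "i \<noteq> j" "4 \<le> N" and F: "integrable gauss2 F"
  shows "integrable (sphere_measure N) (\<lambda>v. F (v i, v j))"
    and "(\<integral>v. F (v i, v j) \<partial>sphere_measure N) = pair_expectation N F"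
proof -
  note D = distr_sphere_pair[OF assms(1-4)]
  note m = sphere_coordinate_pair_measurable[OF assms(1,2)]
  have Fb[measurable]: "F \<in> borel_measurable borel" using F by (auto dest: borel_measurable_integrable)
  have eq: "(\<lambda>z. pair_ratio N (norm_sq z) / pair_mass N * F z) = (\<lambda>z. F z * pair_ratio N (norm_sq z) / pair_mass N)"
    by (simp add: mult.commute)
  have nn: "AE z in gauss2. 0 \<le> pair_ratio N (norm_sq z) / pair_mass N"
    using D(1) pair_ratio_nonneg by (auto intro: less_imp_le divide_nonneg_pos)
  have "integrable (distr (sphere_measure N) borel (\<lambda>v. (v i, v j))) F"
    unfolding D(2) using nn integrable_mult_pair_ratio[OF F assms(4)]
    by (subst integrable_density) (auto simp: mult.commute)
  then show "integrable (sphere_measure N) (\<lambda>v. F (v i, v j))"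
    using m by (subst (asm) integrable_distr_eq) auto
  have "(\<integral>v. F (v i, v j) \<partial>sphere_measure N) = (\<integral>z. F z \<partial>distr (sphere_measure N) borel (\<lambda>v. (v i, v j)))"
    using m by (subst integral_distr) auto
  also have "\<dots> = pair_expectation N F"
    unfolding D(2) pair_expectation_def using nn by (subst integral_density) (auto simp: mult.commute)
  finally show "(\<integral>v. F (v i, v j) \<partial>sphere_measure N) = pair_expectation N F" .
qed

lemma integral_pair_ratio_tendsto:
  assumes F: "integrable gauss2 F"
  shows "(\<lambda>N. \<integral>z. F z * pair_ratio N (norm_sq z) \<partial>gauss2) \<longlonglongrightarrow> (\<integral>z. F z \<partial>gauss2)"
proof -
  have [measurable]: "F \<in> borel_measurable gauss2" using F by simp
  \<comment> \<open>The shift by 4 makes the uniform bound on the quotient available for every term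
    of the sequence.\<close>
  have "(\<lambda>N. \<integral>z. F z * pair_ratio (N + 4) (norm_sq z) \<partial>gauss2) \<longlonglongrightarrow> (\<integral>z. F z * 1 \<partial>gauss2)"
  proof (rule integral_dominated_convergence[where w="\<lambda>z. exp 2 * \<bar>F z\<bar>"])
    show "AE z in gauss2. (\<lambda>N. F z * pair_ratio (N + 4) (norm_sq z)) \<longlonglongrightarrow> F z * 1"
      by (intro AE_I2 tendsto_mult tendsto_const LIMSEQ_ignore_initial_segment[OF pair_ratio_tendsto]) simp
    show "AE z in gauss2. norm (F z * pair_ratio (N + 4) (norm_sq z)) \<le> exp 2 * \<bar>F z\<bar>" for N
      using pair_ratio_le[of "N + 4"] pair_ratio_nonneg
      by (auto simp: abs_mult mult.commute[of "exp 2"] intro!: mult_left_mono)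
  qed (use F in auto)
  then show ?thesis by (simp add: LIMSEQ_offset)
qed

lemma pair_mass_tendsto: "pair_mass \<longlonglongrightarrow> 1"
  using integral_pair_ratio_tendsto[of "\<lambda>_. 1"] by (simp add: pair_mass_def[abs_def] gauss2.prob_space[simplified])

lemma pair_expectation_tendsto:
  assumes "integrable gauss2 F"
  shows "(\<lambda>N. pair_expectation N F) \<longlonglongrightarrow> (\<integral>z. F z \<partial>gauss2)"
  using tendsto_divide[OF integral_pair_ratio_tendsto[OF assms] pair_mass_tendsto]
  by (simp add: pair_expectation_def)

text \<open>As \<open>F\<close> has Gaussian mean 0, replacing the quotient by the quotient minus 1
  changes nothing, and the factor N meets a difference of order 1/N. For the same reason
  \<open>pair_mass\<close> enters only through its limit 1, and its own correction of order 1/N does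
  not appear.\<close>

lemma pair_expectation_first_order:
  assumes F: "integrable gauss2 F" "(\<integral>z. F z \<partial>gauss2) = 0"
    and F2: "integrable gauss2 (\<lambda>z. F z * (2 * norm_sq z + (norm_sq z)\<^sup>2))"
  shows "(\<lambda>N. real N * pair_expectation N F) \<longlonglongrightarrow> (\<integral>z. F z * (2 * norm_sq z - (norm_sq z)\<^sup>2 / 4) \<partial>gauss2)"
proof -
  have [measurable]: "F \<in> borel_measurable gauss2" using F by simp
  have [measurable]: "(\<lambda>z. norm_sq z) \<in> borel_measurable gauss2" by simp
  let ?g = "\<lambda>N z. F z * (real N * (pair_ratio N (norm_sq z) - 1))"
  have "(\<lambda>N. \<integral>z. ?g (N + 4) z \<partial>gauss2) \<longlonglongrightarrow> (\<integral>z. F z * (2 * norm_sq z - (norm_sq z)\<^sup>2 / 4) \<partial>gauss2)"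
  proof (rule integral_dominated_convergence[where w="\<lambda>z. exp 2 * \<bar>F z * (2 * norm_sq z + (norm_sq z)\<^sup>2)\<bar>"])
    show "integrable gauss2 (\<lambda>z. exp 2 * \<bar>F z * (2 * norm_sq z + (norm_sq z)\<^sup>2)\<bar>)"
      using F2 by (intro integrable_mult_right integrable_abs)
    show "AE z in gauss2. (\<lambda>N. ?g (N + 4) z) \<longlonglongrightarrow> F z * (2 * norm_sq z - (norm_sq z)\<^sup>2 / 4)"
      by (intro AE_I2 tendsto_mult[OF tendsto_const] LIMSEQ_ignore_initial_segment[OF pair_ratio_first_order]) simp
    show "AE z in gauss2. norm (?g (N + 4) z) \<le> exp 2 * \<bar>F z * (2 * norm_sq z + (norm_sq z)\<^sup>2)\<bar>" for N
    proof (rule AE_I2)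
      fix z
      have "norm (?g (N + 4) z) \<le> \<bar>F z\<bar> * (exp 2 * (2 * norm_sq z + (norm_sq z)\<^sup>2))"
        unfolding real_norm_def abs_mult[of "F z"] by (intro mult_left_mono pair_ratio_first_order_le) auto
      then show "norm (?g (N + 4) z) \<le> exp 2 * \<bar>F z * (2 * norm_sq z + (norm_sq z)\<^sup>2)\<bar>"
        by (simp add: abs_mult mult_ac)
    qed
  qed measurable
  then have lim: "(\<lambda>N. \<integral>z. ?g N z \<partial>gauss2) \<longlonglongrightarrow> (\<integral>z. F z * (2 * norm_sq z - (norm_sq z)\<^sup>2 / 4) \<partial>gauss2)"
    by (rule LIMSEQ_offset)
  have "eventually (\<lambda>N. (\<integral>z. ?g N z \<partial>gauss2) / pair_mass N = real N * pair_expectation N F) sequentially"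
    using eventually_ge_at_top[of 4]
  proof eventually_elim
    case (elim N)
    have "(\<integral>z. ?g N z \<partial>gauss2) = (\<integral>z. real N * (F z * pair_ratio N (norm_sq z)) - real N * F z \<partial>gauss2)"
      by (intro Bochner_Integration.integral_cong) (auto simp: algebra_simps)
    also have "\<dots> = real N * (\<integral>z. F z * pair_ratio N (norm_sq z) \<partial>gauss2)"
      using F integrable_mult_pair_ratio[OF F(1) elim] by (subst Bochner_Integration.integral_diff) auto
    finally show ?case by (simp add: pair_expectation_def)
  qed
  then show ?thesis
    using tendsto_divide[OF lim pair_mass_tendsto] by (simp add: tendsto_cong)
qed

lemma integrable_gauss2_prod:
  fixes f g :: "real \<Rightarrow> real"
  assumes f: "integrable maxwellian f" and g: "integrable maxwellian g"
  shows "integrable gauss2 (\<lambda>z. f (fst z) * g (snd z))"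
    and "(\<integral>z. f (fst z) * g (snd z) \<partial>gauss2) = (\<integral>v. f v \<partial>maxwellian) * (\<integral>v. g v \<partial>maxwellian)"
proof -
  have [measurable]: "f \<in> borel_measurable maxwellian" "g \<in> borel_measurable maxwellian"
    using f g by auto
  show I: "integrable gauss2 (\<lambda>z. f (fst z) * g (snd z))"
    unfolding gauss2_def
  proof (rule maxwellian2.Fubini_integrable)
    show "integrable maxwellian (\<lambda>x. \<integral>y. norm (f (fst (x, y)) * g (snd (x, y))) \<partial>maxwellian)"
      using f g by (simp add: abs_mult)
  qed (use g in auto)
  show "(\<integral>z. f (fst z) * g (snd z) \<partial>gauss2) = (\<integral>v. f v \<partial>maxwellian) * (\<integral>v. g v \<partial>maxwellian)"
    using maxwellian2.integral_fst'[OF I[unfolded gauss2_def]] by (simp add: gauss2_def)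
qed

section \<open>Rotations and the linearized form\<close>

definition rot :: "real \<Rightarrow> real \<times> real \<Rightarrow> real \<times> real" where
  "rot \<theta> z = (fst z * cos \<theta> + snd z * sin \<theta>, - fst z * sin \<theta> + snd z * cos \<theta>)"

lemma rot_rot: "rot a (rot b z) = rot (a + b) z"
  by (simp add: rot_def cos_add sin_add algebra_simps)

lemma norm_sq_rot [simp]: "norm_sq (rot \<theta> z) = norm_sq z"
proof -
  have "norm_sq (rot \<theta> z) = norm_sq z * ((cos \<theta>)\<^sup>2 + (sin \<theta>)\<^sup>2)"
    unfolding rot_def fst_conv snd_conv by algebra
  then show ?thesis by simp
qed

lemma rot_measurable2 [measurable]: "(\<lambda>(z, \<theta>). rot \<theta> z) \<in> borel \<Otimes>\<^sub>M borel \<rightarrow>\<^sub>M borel"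
  unfolding rot_def borel_prod[symmetric] by measurable

lemma rot_measurable [measurable]: "rot \<theta> \<in> borel \<rightarrow>\<^sub>M borel"
  unfolding rot_def[abs_def] borel_prod[symmetric] by measurable

lemma rot_measurable_angle: "(\<lambda>\<theta>. rot \<theta> z) \<in> borel \<rightarrow>\<^sub>M borel"
  unfolding rot_def[abs_def] borel_prod[symmetric] by measurable

text \<open>A rotation is a product of three shears, and shears preserve Lebesgue measure by Tonelli.\<close>

lemma nn_integral_shear:
  fixes F :: "real \<times> real \<Rightarrow> ennreal"
  assumes F: "F \<in> borel_measurable borel"
  shows "(\<integral>\<^sup>+z. F (fst z + t * snd z, snd z) \<partial>lborel) = (\<integral>\<^sup>+z. F z \<partial>lborel)"
    and "(\<integral>\<^sup>+z. F (fst z, snd z + t * fst z) \<partial>lborel) = (\<integral>\<^sup>+z. F z \<partial>lborel)"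
proof -
  have [measurable]: "F \<in> borel_measurable (lborel \<Otimes>\<^sub>M lborel)" "F \<in> borel_measurable (borel \<Otimes>\<^sub>M borel)"
    using F by (simp_all add: lborel_prod borel_prod)
  have shift: "(\<integral>\<^sup>+x. f (x + c) \<partial>lborel) = (\<integral>\<^sup>+x. f x \<partial>lborel)"
    if "f \<in> borel_measurable borel" for f :: "real \<Rightarrow> ennreal" and c
    using nn_integral_real_affine[OF that, of 1 c] by (simp add: add.commute)
  have "(\<integral>\<^sup>+z. F (fst z + t * snd z, snd z) \<partial>(lborel \<Otimes>\<^sub>M lborel)) = (\<integral>\<^sup>+w. \<integral>\<^sup>+v. F (v + t * w, w) \<partial>lborel \<partial>lborel)"
    by (subst lborel_pair.nn_integral_snd[symmetric]) simp_all
  also have "\<dots> = (\<integral>\<^sup>+w. \<integral>\<^sup>+v. F (v, w) \<partial>lborel \<partial>lborel)"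
    by (intro nn_integral_cong shift) measurable
  also have "\<dots> = (\<integral>\<^sup>+z. F z \<partial>(lborel \<Otimes>\<^sub>M lborel))"
    by (subst lborel_pair.nn_integral_snd[symmetric]) simp_all
  finally show "(\<integral>\<^sup>+z. F (fst z + t * snd z, snd z) \<partial>lborel) = (\<integral>\<^sup>+z. F z \<partial>lborel)"
    by (simp add: lborel_prod)
  have "(\<integral>\<^sup>+z. F (fst z, snd z + t * fst z) \<partial>(lborel \<Otimes>\<^sub>M lborel)) = (\<integral>\<^sup>+v. \<integral>\<^sup>+w. F (v, w + t * v) \<partial>lborel \<partial>lborel)"
    by (subst lborel.nn_integral_fst[symmetric]) simp_all
  also have "\<dots> = (\<integral>\<^sup>+v. \<integral>\<^sup>+w. F (v, w) \<partial>lborel \<partial>lborel)"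
    by (intro nn_integral_cong shift) measurable
  also have "\<dots> = (\<integral>\<^sup>+z. F z \<partial>(lborel \<Otimes>\<^sub>M lborel))"
    by (subst lborel.nn_integral_fst[symmetric]) simp_all
  finally show "(\<integral>\<^sup>+z. F (fst z, snd z + t * fst z) \<partial>lborel) = (\<integral>\<^sup>+z. F z \<partial>lborel)"
    by (simp add: lborel_prod)
qed

lemma nn_integral_lborel_rot:
  fixes F :: "real \<times> real \<Rightarrow> ennreal"
  assumes F[measurable]: "F \<in> borel_measurable borel"
  shows "(\<integral>\<^sup>+z. F (rot \<theta> z) \<partial>lborel) = (\<integral>\<^sup>+z. F z \<partial>lborel)"
proof -
  have main: "(\<integral>\<^sup>+z. F (rot \<theta> z) \<partial>lborel) = (\<integral>\<^sup>+z. F z \<partial>lborel)"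
    if F: "F \<in> borel_measurable borel" and c: "cos \<theta> \<noteq> -1" for F :: "real \<times> real \<Rightarrow> ennreal" and \<theta>
  proof -
    define s where "s = sin \<theta>"
    \<comment> \<open>This is tan(\<theta>/2). The rotation is the shear of the first coordinate by
      \<open>t\<close>, then of the second by \<open>- sin \<theta>\<close>, then of the first by
      \<open>t\<close> again; only at a half turn is there no such factorization.\<close>
    define t where "t = s / (1 + cos \<theta>)"
    define A where "A z = (fst z + t * snd z, snd z)" for z :: "real \<times> real"
    define B where "B z = (fst z, snd z + (- s) * fst z)" for z :: "real \<times> real"
    have [measurable]: "A \<in> borel \<rightarrow>\<^sub>M borel" "B \<in> borel \<rightarrow>\<^sub>M borel"
      unfolding A_def[abs_def] B_def[abs_def] borel_prod[symmetric] by measurable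
    have c': "1 + cos \<theta> \<noteq> 0" using c by linarith
    have t1: "t * (1 + cos \<theta>) = s" using c' by (simp add: t_def)
    have "(t * s) * (1 + cos \<theta>) = (1 - cos \<theta>) * (1 + cos \<theta>)"
    proof -
      have "(t * s) * (1 + cos \<theta>) = s\<^sup>2" using t1 by (simp only: power2_eq_square mult_ac)
      also have "\<dots> = (1 - cos \<theta>) * (1 + cos \<theta>)"
        unfolding s_def sin_squared_eq by (simp add: power2_eq_square algebra_simps)
      finally show ?thesis .
    qed
    then have t2: "t * s = 1 - cos \<theta>" using c' by simp
    have eq: "A (B (A z)) = rot \<theta> z" for z
    proof -
      obtain v w where z: "z = (v, w)" by fastforce
      have 1: "w + - s * (v + t * w) = - v * sin \<theta> + w * cos \<theta>"
      proof -
        have "w + - s * (v + t * w) = w * (1 - t * s) - v * s" by (simp add: algebra_simps)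
        then show ?thesis unfolding t2 by (simp add: s_def algebra_simps)
      qed
      have 2: "v + t * w + t * (- v * sin \<theta> + w * cos \<theta>) = v * cos \<theta> + w * sin \<theta>"
      proof -
        have "v + t * w + t * (- v * sin \<theta> + w * cos \<theta>) = v * (1 - t * s) + w * (t * (1 + cos \<theta>))"
          by (simp add: s_def algebra_simps)
        then show ?thesis unfolding t1 t2 by (simp add: s_def)
      qed
      show ?thesis unfolding A_def B_def rot_def z fst_conv snd_conv 1 2 ..
    qed
    note nnA = nn_integral_shear(1)[where t=t, folded A_def]
    note nnB = nn_integral_shear(2)[where t="-s", folded B_def]
    have "(\<integral>\<^sup>+z. F (rot \<theta> z) \<partial>lborel) = (\<integral>\<^sup>+z. F (A (B (A z))) \<partial>lborel)"
      by (simp only: eq)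
    also have "\<dots> = (\<integral>\<^sup>+z. F (A (B z)) \<partial>lborel)"
      by (rule nnA[of "\<lambda>z. F (A (B z))"]) (use F in measurable)
    also have "\<dots> = (\<integral>\<^sup>+z. F (A z) \<partial>lborel)"
      by (rule nnB[of "\<lambda>z. F (A z)"]) (use F in measurable)
    also have "\<dots> = (\<integral>\<^sup>+z. F z \<partial>lborel)" by (rule nnA[OF F])
    finally show ?thesis .
  qed
  show ?thesis
  proof (cases "cos \<theta> = -1")
    case False
    then show ?thesis by (rule main[OF F])
  next
    case True
    \<comment> \<open>A half turn is the product of two rotations by \<theta>/2, whose cosine is 0,
      so that the shears exist for them.\<close>
    have "cos \<theta> = 2 * (cos (\<theta> / 2))\<^sup>2 - 1" using cos_double_cos[of "\<theta> / 2"] by simp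
    then have half: "cos (\<theta> / 2) \<noteq> -1" using True by auto
    have "(\<integral>\<^sup>+z. F (rot \<theta> z) \<partial>lborel) = (\<integral>\<^sup>+z. F (rot (\<theta>/2) (rot (\<theta>/2) z)) \<partial>lborel)"
      by (simp add: rot_rot)
    also have "\<dots> = (\<integral>\<^sup>+z. F z \<partial>lborel)"
      by (subst main[OF _ half], simp, rule main[OF F half])
    finally show ?thesis .
  qed
qed

text \<open>Lebesgue measure is invariant and the Gaussian density depends on \<open>norm_sq\<close>
  alone.\<close>

lemma distr_gauss2_rot: "distr gauss2 borel (rot \<theta>) = gauss2"
proof (rule measure_eqI)
  fix A assume "A \<in> sets (distr gauss2 borel (rot \<theta>))"
  then have [measurable]: "A \<in> sets borel" by simp
  let ?g = "\<lambda>z :: real \<times> real. ennreal (exp (- norm_sq z / 2) / (2 * pi))"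
  have gm[measurable]: "?g \<in> borel_measurable borel" by measurable
  have rm: "rot \<theta> \<in> gauss2 \<rightarrow>\<^sub>M borel" using rot_measurable[of \<theta>] by simp
  have "emeasure (distr gauss2 borel (rot \<theta>)) A = (\<integral>\<^sup>+z. indicator A (rot \<theta> z) \<partial>gauss2)"
    by (subst nn_integral_indicator[symmetric], simp, subst nn_integral_distr[OF rm]) simp_all
  also have "\<dots> = (\<integral>\<^sup>+z. ?g (rot \<theta> z) * indicator A (rot \<theta> z) \<partial>lborel)"
    unfolding gauss2_density norm_sq_rot by (rule nn_integral_density) (use gm in simp, measurable)
  also have "\<dots> = (\<integral>\<^sup>+z. ?g z * indicator A z \<partial>lborel)"
    by (rule nn_integral_lborel_rot) measurable
  also have "\<dots> = emeasure gauss2 A"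
    unfolding gauss2_density by (rule emeasure_density[symmetric]) (use gm in simp_all)
  finally show "emeasure (distr gauss2 borel (rot \<theta>)) A = emeasure gauss2 A" .
qed simp

section \<open>Uniform angles and averages over circles\<close>

definition angle :: "real measure" where
  "angle = uniform_measure lborel {-pi..pi}"

lemma sets_angle [simp, measurable_cong]: "sets angle = sets borel"
  by (simp add: angle_def)

lemma space_angle [simp]: "space angle = UNIV"
  by (simp add: angle_def)

interpretation angle: prob_space angle
  unfolding angle_def by (rule prob_space_uniform_measure) auto

interpretation gauss2_angle: pair_prob_space gauss2 angle ..

lemma inverse_ennreal_two_pi: "inverse (ennreal (2 * pi)) = ennreal (1 / (2 * pi))"
  by (subst inverse_ennreal) (simp_all only: inverse_eq_divide, simp)

lemma nn_integral_angle:
  assumes [measurable]: "f \<in> borel_measurable borel"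
  shows "(\<integral>\<^sup>+\<theta>. f \<theta> \<partial>angle) = (\<integral>\<^sup>+\<theta>. f \<theta> * indicator {-pi..pi} \<theta> \<partial>lborel) / ennreal (2 * pi)"
  unfolding angle_def by (subst nn_integral_uniform_measure) auto

text \<open>The shifted window from \<open>-pi + a\<close> to \<open>pi + a\<close> is cut at
  \<open>pi\<close> and the overhang is moved back by one period; the endpoints counted twice or
  left out form a null set.\<close>

lemma nn_integral_angle_shift:
  fixes f :: "real \<Rightarrow> ennreal"
  assumes [measurable]: "f \<in> borel_measurable borel" and per: "\<And>x. f (x + 2 * pi) = f x"
    and a: "0 \<le> a" "a \<le> 2 * pi"
  shows "(\<integral>\<^sup>+\<theta>. f (\<theta> + a) \<partial>angle) = (\<integral>\<^sup>+\<theta>. f \<theta> \<partial>angle)"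
proof -
  have "(\<integral>\<^sup>+x. f (x + a) * indicator {-pi..pi} x \<partial>lborel) = (\<integral>\<^sup>+x. f x * indicator {-pi + a..pi + a} x \<partial>lborel)"
    by (subst nn_integral_real_affine[where c=1 and t=a and f="\<lambda>x. f x * indicator {-pi + a..pi + a} x"])
      (auto intro!: nn_integral_cong simp: add.commute split: split_indicator)
  also have "\<dots> = (\<integral>\<^sup>+x. f x * indicator {-pi + a..pi} x + f x * indicator {pi<..pi + a} x \<partial>lborel)"
    using a by (intro nn_integral_cong) (auto split: split_indicator)
  also have "\<dots> = (\<integral>\<^sup>+x. f x * indicator {-pi + a..pi} x \<partial>lborel) + (\<integral>\<^sup>+x. f x * indicator {pi<..pi + a} x \<partial>lborel)"
    by (rule nn_integral_add) measurable
  also have "(\<integral>\<^sup>+x. f x * indicator {pi<..pi + a} x \<partial>lborel) = (\<integral>\<^sup>+x. f x * indicator {-pi<..-pi + a} x \<partial>lborel)"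
    by (subst nn_integral_real_affine[where c=1 and t="2 * pi"])
      (auto intro!: nn_integral_cong simp: per[unfolded add.commute[of _ "2 * pi"]] split: split_indicator)
  also have "(\<integral>\<^sup>+x. f x * indicator {-pi + a..pi} x \<partial>lborel) + \<dots> = (\<integral>\<^sup>+x. f x * indicator {-pi + a..pi} x + f x * indicator {-pi<..-pi + a} x \<partial>lborel)"
    by (rule nn_integral_add[symmetric]) measurable
  also have "\<dots> = (\<integral>\<^sup>+x. f x * indicator {-pi..pi} x \<partial>lborel)"
  proof (rule nn_integral_cong_AE)
    have "AE x in lborel. x \<noteq> -pi \<and> x \<noteq> -pi + a"
      by (intro AE_conjI AE_lborel_singleton)
    then show "AE x in lborel. f x * indicator {-pi + a..pi} x + f x * indicator {-pi<..-pi + a} x = f x * indicator {-pi..pi} x"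
      by eventually_elim (use a in \<open>auto split: split_indicator\<close>)
  qed
  finally show ?thesis
    by (subst (1 2) nn_integral_angle) simp_all
qed

text \<open>A rotation depends on its angle only through cosine and sine, so \<open>a\<close> can be
  reduced to [0, 2 pi), where the periodic shift applies. Stating equality of laws covers all
  measurable functions on the circle at once, integrable or not.\<close>

lemma distr_angle_rot_shift:
  "distr angle borel (\<lambda>\<theta>. rot (\<theta> + a) z) = distr angle borel (\<lambda>\<theta>. rot \<theta> z)"
proof -
  have m: "(\<lambda>\<theta>. rot \<theta> z) \<in> angle \<rightarrow>\<^sub>M borel" using rot_measurable_angle by simp
  have main: "distr angle borel (\<lambda>\<theta>. rot (\<theta> + a) z) = distr angle borel (\<lambda>\<theta>. rot \<theta> z)"
    if a: "0 \<le> a" "a \<le> 2 * pi" for a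
  proof (rule measure_eqI)
    have ma: "(\<lambda>\<theta>. rot (\<theta> + a) z) \<in> angle \<rightarrow>\<^sub>M borel"
      using measurable_compose[OF _ rot_measurable_angle, of "\<lambda>\<theta>. \<theta> + a" borel z] by simp
    fix A assume "A \<in> sets (distr angle borel (\<lambda>\<theta>. rot (\<theta> + a) z))"
    then have [measurable]: "A \<in> sets borel" by simp
    have "emeasure (distr angle borel (\<lambda>\<theta>. rot (\<theta> + a) z)) A = (\<integral>\<^sup>+\<theta>. indicator A (rot (\<theta> + a) z) \<partial>angle)"
      by (subst nn_integral_indicator[symmetric], simp, subst nn_integral_distr[OF ma]) simp_all
    also have "\<dots> = (\<integral>\<^sup>+\<theta>. indicator A (rot \<theta> z) \<partial>angle)"
      using rot_measurable_angle[of z] by (intro nn_integral_angle_shift a) (auto simp: rot_def)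
    also have "\<dots> = emeasure (distr angle borel (\<lambda>\<theta>. rot \<theta> z)) A"
      by (subst nn_integral_indicator[symmetric], simp, subst nn_integral_distr[OF m]) simp_all
    finally show "emeasure (distr angle borel (\<lambda>\<theta>. rot (\<theta> + a) z)) A = emeasure (distr angle borel (\<lambda>\<theta>. rot \<theta> z)) A" .
  qed simp
  obtain t where t: "0 \<le> t" "t < 2 * pi" "cos a = cos t" "sin a = sin t"
    using sincos_total_2pi[of "cos a" "sin a"] by auto
  have "rot (\<theta> + a) z = rot (\<theta> + t) z" for \<theta>
    using t by (simp add: rot_def cos_add sin_add)
  then show ?thesis using main[of t] t by simp
qed

lemma distr_angle_uminus: "distr angle borel uminus = angle"
proof (rule measure_eqI)
  fix A assume "A \<in> sets (distr angle borel uminus)"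
  then have [measurable]: "A \<in> sets borel" by simp
  have m: "uminus \<in> angle \<rightarrow>\<^sub>M borel" by simp
  have "emeasure (distr angle borel uminus) A = (\<integral>\<^sup>+\<theta>. indicator A (- \<theta>) \<partial>angle)"
    by (subst nn_integral_indicator[symmetric], simp, subst nn_integral_distr[OF m]) simp_all
  also have "\<dots> = (\<integral>\<^sup>+\<theta>. indicator A \<theta> \<partial>angle)"
    by (subst (1 2) nn_integral_angle,
        simp, simp, subst (2) nn_integral_real_affine[where c="-1" and t=0])
       (auto intro!: arg_cong2[where f="(/)"] nn_integral_cong split: split_indicator)
  also have "\<dots> = emeasure angle A" by simp
  finally show "emeasure (distr angle borel uminus) A = emeasure angle A" .
qed simp

lemma rot_measurable_pair: "(\<lambda>p. rot (snd p) (fst p)) \<in> gauss2 \<Otimes>\<^sub>M angle \<rightarrow>\<^sub>M borel"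
  using rot_measurable2 by (simp add: split_beta' cong: measurable_cong_sets sets_pair_measure_cong)

text \<open>The Gaussian is invariant under each fixed rotation, hence under rotation by an
  independent angle. Gaussian integrals can thus be averaged over circles about the origin without
  polar coordinates.\<close>

lemma distr_gauss2_angle_rot: "distr (gauss2 \<Otimes>\<^sub>M angle) borel (\<lambda>p. rot (snd p) (fst p)) = gauss2"
proof (rule measure_eqI)
  fix A assume "A \<in> sets (distr (gauss2 \<Otimes>\<^sub>M angle) borel (\<lambda>p. rot (snd p) (fst p)))"
  then have A[measurable]: "A \<in> sets borel" by simp
  note [measurable] = rot_measurable_pair
  have "emeasure (distr (gauss2 \<Otimes>\<^sub>M angle) borel (\<lambda>p. rot (snd p) (fst p))) A
     = (\<integral>\<^sup>+p. indicator A (rot (snd p) (fst p)) \<partial>(gauss2 \<Otimes>\<^sub>M angle))"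
    by (subst nn_integral_indicator[symmetric], simp, subst nn_integral_distr[OF rot_measurable_pair]) simp_all
  also have "\<dots> = (\<integral>\<^sup>+\<theta>. \<integral>\<^sup>+z. indicator A (rot \<theta> z) \<partial>gauss2 \<partial>angle)"
    by (subst gauss2_angle.nn_integral_snd[symmetric]) simp_all
  also have "\<dots> = (\<integral>\<^sup>+\<theta>. emeasure (distr gauss2 borel (rot \<theta>)) A \<partial>angle)"
  proof (rule nn_integral_cong)
    fix \<theta>
    have rm: "rot \<theta> \<in> gauss2 \<rightarrow>\<^sub>M borel" using rot_measurable[of \<theta>] by simp
    show "(\<integral>\<^sup>+z. indicator A (rot \<theta> z) \<partial>gauss2) = emeasure (distr gauss2 borel (rot \<theta>)) A"
      by (subst nn_integral_indicator[symmetric], simp, subst nn_integral_distr[OF rm]) simp_all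
  qed
  also have "\<dots> = emeasure gauss2 A" by (simp add: distr_gauss2_rot angle.emeasure_space_1[simplified])
  finally show "emeasure (distr (gauss2 \<Otimes>\<^sub>M angle) borel (\<lambda>p. rot (snd p) (fst p))) A = emeasure gauss2 A" .
qed simp

lemma integrable_rot:
  fixes G :: "real \<times> real \<Rightarrow> real"
  assumes G: "integrable gauss2 G"
  shows "integrable (gauss2 \<Otimes>\<^sub>M angle) (\<lambda>p. G (rot (snd p) (fst p)))"
    and "(\<integral>p. G (rot (snd p) (fst p)) \<partial>(gauss2 \<Otimes>\<^sub>M angle)) = (\<integral>z. G z \<partial>gauss2)"
proof -
  have Gb: "G \<in> borel_measurable borel" using G by (auto dest: borel_measurable_integrable)
  show "integrable (gauss2 \<Otimes>\<^sub>M angle) (\<lambda>p. G (rot (snd p) (fst p)))"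
    using G integrable_distr_eq[OF rot_measurable_pair Gb] by (simp add: distr_gauss2_angle_rot)
  show "(\<integral>p. G (rot (snd p) (fst p)) \<partial>(gauss2 \<Otimes>\<^sub>M angle)) = (\<integral>z. G z \<partial>gauss2)"
    using integral_distr[OF rot_measurable_pair Gb] by (simp add: distr_gauss2_angle_rot)
qed

lemma nn_integral_rot:
  assumes "G \<in> borel_measurable borel"
  shows "(\<integral>\<^sup>+z. G z \<partial>gauss2) = (\<integral>\<^sup>+z. \<integral>\<^sup>+\<theta>. G (rot \<theta> z) \<partial>angle \<partial>gauss2)"
proof -
  note [measurable] = rot_measurable_pair assms
  have "(\<integral>\<^sup>+z. G z \<partial>gauss2) = (\<integral>\<^sup>+p. G (rot (snd p) (fst p)) \<partial>(gauss2 \<Otimes>\<^sub>M angle))"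
    using nn_integral_distr[OF rot_measurable_pair, of G] assms by (simp add: distr_gauss2_angle_rot)
  also have "\<dots> = (\<integral>\<^sup>+z. \<integral>\<^sup>+\<theta>. G (rot \<theta> z) \<partial>angle \<partial>gauss2)"
    by (subst angle.nn_integral_fst[symmetric]) simp_all
  finally show ?thesis .
qed

section \<open>Pair sums, their circle means and the deviation from them\<close>

definition pair_sum :: "(real \<Rightarrow> real) \<Rightarrow> real \<times> real \<Rightarrow> real" where
  "pair_sum h z = h (fst z) + h (snd z)"

text \<open>Where \<open>pair_sum h\<close> is not integrable along the circle the value is 0 by
  convention; for Maxwellian-integrable \<open>h\<close> this happens only on a null set of points
  \<open>z\<close>.\<close>

definition circle_mean :: "(real \<Rightarrow> real) \<Rightarrow> real \<times> real \<Rightarrow> real" where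
  "circle_mean h z = (\<integral>\<theta>. pair_sum h (rot \<theta> z) \<partial>angle)"

text \<open>For the additive function f with summand \<open>h\<close>, this is f minus its average
  over rotations of coordinates i and j, evaluated at \<open>(v i, v j)\<close>; the other
  coordinates cancel.\<close>

definition deviation :: "(real \<Rightarrow> real) \<Rightarrow> real \<times> real \<Rightarrow> real" where
  "deviation h z = pair_sum h z - circle_mean h z"

lemma measurable_fst_borel [measurable]: "h \<in> borel_measurable borel \<Longrightarrow> (\<lambda>z :: real \<times> real. h (fst z) :: real) \<in> borel_measurable borel"
  unfolding borel_prod[symmetric] by (rule measurable_compose[OF measurable_fst])

lemma measurable_snd_borel [measurable]: "h \<in> borel_measurable borel \<Longrightarrow> (\<lambda>z :: real \<times> real. h (snd z) :: real) \<in> borel_measurable borel"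
  unfolding borel_prod[symmetric] by (rule measurable_compose[OF measurable_snd])

lemma pair_sum_measurable [measurable]:
  assumes [measurable]: "h \<in> borel_measurable borel"
  shows "pair_sum h \<in> borel_measurable borel"
  unfolding pair_sum_def[abs_def] by measurable

lemma circle_mean_measurable [measurable]:
  assumes [measurable]: "h \<in> borel_measurable borel"
  shows "circle_mean h \<in> borel_measurable borel"
proof -
  note [measurable] = rot_measurable_pair
  have "(\<lambda>(z, \<theta>). pair_sum h (rot \<theta> z)) \<in> borel_measurable (gauss2 \<Otimes>\<^sub>M angle)"
    unfolding split_beta' by measurable
  from angle.borel_measurable_lebesgue_integral[OF this]
  show ?thesis by (simp add: circle_mean_def[abs_def])
qed

lemma deviation_measurable [measurable]:
  assumes [measurable]: "h \<in> borel_measurable borel"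
  shows "deviation h \<in> borel_measurable borel"
  unfolding deviation_def[abs_def] by measurable

text \<open>Rotating \<open>z\<close> shifts the angle, which leaves the law on the circle
  unchanged. The identity therefore holds at every point, including those where the mean is a
  default value.\<close>

lemma circle_mean_rot:
  assumes [measurable]: "h \<in> borel_measurable borel"
  shows "circle_mean h (rot a z) = circle_mean h z"
proof -
  have m: "(\<lambda>\<theta>. rot \<theta> z) \<in> angle \<rightarrow>\<^sub>M borel" using rot_measurable_angle by simp
  have ma: "(\<lambda>\<theta>. rot (\<theta> + a) z) \<in> angle \<rightarrow>\<^sub>M borel"
    using measurable_compose[OF _ rot_measurable_angle, of "\<lambda>\<theta>. \<theta> + a" borel z] by simp
  have "circle_mean h (rot a z) = (\<integral>x. pair_sum h x \<partial>distr angle borel (\<lambda>\<theta>. rot (\<theta> + a) z))"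
    unfolding circle_mean_def rot_rot by (rule integral_distr[symmetric, OF ma]) simp
  also have "\<dots> = circle_mean h z"
    unfolding circle_mean_def distr_angle_rot_shift by (rule integral_distr[OF m]) simp
  finally show ?thesis .
qed

text \<open>Rotating the swapped point by \<theta> is the same as rotating the original by -\<theta>
  and swapping the result. \<open>pair_sum\<close> is symmetric, and the uniform angle is invariant
  under change of sign.\<close>

lemma circle_mean_swap:
  assumes [measurable]: "h \<in> borel_measurable borel"
  shows "circle_mean h (prod.swap z) = circle_mean h z"
proof -
  have m: "(\<lambda>\<theta>. rot \<theta> z) \<in> borel \<rightarrow>\<^sub>M borel" using rot_measurable_angle by simp
  have u: "uminus \<in> angle \<rightarrow>\<^sub>M borel" by simp
  have f: "(\<lambda>\<theta>. pair_sum h (rot \<theta> z)) \<in> borel_measurable borel"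
    by (rule measurable_compose[OF m]) simp
  have "circle_mean h (prod.swap z) = (\<integral>\<theta>. pair_sum h (rot (- \<theta>) z) \<partial>angle)"
    unfolding circle_mean_def by (intro Bochner_Integration.integral_cong) (auto simp: pair_sum_def rot_def algebra_simps)
  also have "\<dots> = (\<integral>\<theta>. pair_sum h (rot \<theta> z) \<partial>distr angle borel uminus)"
    by (rule integral_distr[symmetric, OF u f])
  also have "\<dots> = circle_mean h z" by (simp add: distr_angle_uminus circle_mean_def)
  finally show ?thesis .
qed

lemma deviation_swap:
  assumes "h \<in> borel_measurable borel"
  shows "deviation h (prod.swap z) = deviation h z"
  using circle_mean_swap[OF assms, of z] by (simp add: deviation_def pair_sum_def)

lemma gauss2_swap:
  fixes F :: "real \<times> real \<Rightarrow> real"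
  assumes "integrable gauss2 F"
  shows "integrable gauss2 (\<lambda>z. F (prod.swap z))" "(\<integral>z. F (prod.swap z) \<partial>gauss2) = (\<integral>z. F z \<partial>gauss2)"
proof -
  have F: "integrable (maxwellian \<Otimes>\<^sub>M maxwellian) F" using assms by (simp add: gauss2_def)
  have eq: "(\<lambda>z. F (prod.swap z)) = (\<lambda>(x, y). F (y, x))" by auto
  show "integrable gauss2 (\<lambda>z. F (prod.swap z))"
    unfolding eq gauss2_def by (rule maxwellian2.integrable_product_swap[OF F])
  show "(\<integral>z. F (prod.swap z) \<partial>gauss2) = (\<integral>z. F z \<partial>gauss2)"
    unfolding eq gauss2_def using maxwellian2.integral_product_swap[of F] F by simp
qed

lemma integrable_pair_sum:
  assumes "integrable maxwellian h"
  shows "integrable gauss2 (pair_sum h)"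
proof -
  have "integrable gauss2 (\<lambda>z. h (fst z) * 1)" "integrable gauss2 (\<lambda>z. 1 * h (snd z))"
    using assms by (intro integrable_gauss2_prod; simp)+
  then show ?thesis unfolding pair_sum_def[abs_def] by simp
qed

text \<open>Rotation invariance makes \<open>pair_sum h\<close> integrable jointly in the point and
  the angle, and Fubini passes to almost every circle.\<close>

lemma AE_integrable_pair_sum_rot:
  assumes "integrable maxwellian h"
  shows "AE z in gauss2. integrable angle (\<lambda>\<theta>. pair_sum h (rot \<theta> z))"
  using gauss2_angle.AE_integrable_fst'[OF integrable_rot(1)[OF integrable_pair_sum[OF assms]]] by simp

text \<open>
  On almost every circle \<open>deviation h\<close> is \<open>pair_sum h\<close> minus its mean, so its square and its product
  with \<open>pair_sum h\<close> have the same mean.  Only the latter is known to be integrable beforehand.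
\<close>

lemma deviation_rot_form:
  assumes h[measurable]: "h \<in> borel_measurable borel" and hi: "integrable maxwellian h"
    and I: "integrable gauss2 (\<lambda>z. norm_sq z powr \<gamma> * (pair_sum h z * deviation h z))"
  shows "integrable gauss2 (\<lambda>z. norm_sq z powr \<gamma> * (deviation h z)\<^sup>2)"
    and "(\<integral>z. norm_sq z powr \<gamma> * (deviation h z)\<^sup>2 \<partial>gauss2) = (\<integral>z. norm_sq z powr \<gamma> * (pair_sum h z * deviation h z) \<partial>gauss2)"
proof -
  define G where "G z = norm_sq z powr \<gamma> * (pair_sum h z * deviation h z)" for z
  define D where "D z = norm_sq z powr \<gamma> * (deviation h z)\<^sup>2" for z
  have GI: "integrable gauss2 G" using I by (simp add: G_def[abs_def])
  note RI = integrable_rot(1)[OF GI]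
  have [measurable]: "D \<in> borel_measurable borel" unfolding D_def[abs_def] by measurable
  have D0: "0 \<le> D z" for z by (simp add: D_def)
  have key: "AE z in gauss2. (\<integral>\<^sup>+\<theta>. ennreal (D (rot \<theta> z)) \<partial>angle) = ennreal (\<integral>\<theta>. G (rot \<theta> z) \<partial>angle)
      \<and> 0 \<le> (\<integral>\<theta>. G (rot \<theta> z) \<partial>angle)"
    using AE_integrable_pair_sum_rot[OF hi] gauss2_angle.AE_integrable_fst'[OF RI]
  proof eventually_elim
    case (elim z)
    define A where "A = circle_mean h z"
    define W where "W = norm_sq z powr \<gamma>"
    have dev: "deviation h (rot \<theta> z) = pair_sum h (rot \<theta> z) - A" for \<theta>
      by (simp add: deviation_def circle_mean_rot A_def)
    \<comment> \<open>\<open>W\<close> and \<open>A\<close> are constant along the circle, so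
      \<open>D\<close> and \<open>G\<close> differ by a constant multiple of
      \<open>pair_sum h\<close> minus its mean, which averages to 0.\<close>
    have Drot: "D (rot \<theta> z) = G (rot \<theta> z) - W * A * (pair_sum h (rot \<theta> z) - A)" for \<theta>
      unfolding D_def G_def dev norm_sq_rot W_def[symmetric] by (simp add: power2_eq_square algebra_simps)
    have 1: "integrable angle (\<lambda>\<theta>. W * A * (pair_sum h (rot \<theta> z) - A))"
      using elim(1) by (intro integrable_mult_right Bochner_Integration.integrable_diff) auto
    have 2: "integrable angle (\<lambda>\<theta>. G (rot \<theta> z))" using elim(2) by simp
    have 3: "(\<integral>\<theta>. W * A * (pair_sum h (rot \<theta> z) - A) \<partial>angle) = 0"
      using elim(1) angle.prob_space by (simp add: Bochner_Integration.integral_diff A_def circle_mean_def)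
    have DI: "integrable angle (\<lambda>\<theta>. D (rot \<theta> z))" unfolding Drot using 1 2 by simp
    have Deq: "(\<integral>\<theta>. D (rot \<theta> z) \<partial>angle) = (\<integral>\<theta>. G (rot \<theta> z) \<partial>angle)"
      unfolding Drot Bochner_Integration.integral_diff[OF 2 1] 3 by simp
    have "(\<integral>\<^sup>+\<theta>. ennreal (D (rot \<theta> z)) \<partial>angle) = ennreal (\<integral>\<theta>. D (rot \<theta> z) \<partial>angle)"
      using DI D0 by (intro nn_integral_eq_integral) auto
    moreover have "0 \<le> (\<integral>\<theta>. D (rot \<theta> z) \<partial>angle)" using D0 by simp
    ultimately show ?case by (simp add: Deq)
  qed
  \<comment> \<open>With values in \<open>ennreal\<close> the circle averages of \<open>D\<close>
    can be taken before \<open>D\<close> is known to be integrable; its finiteness is inherited from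
    \<open>G\<close>.\<close>
  have "(\<integral>\<^sup>+z. ennreal (D z) \<partial>gauss2) = (\<integral>\<^sup>+z. (\<integral>\<^sup>+\<theta>. ennreal (D (rot \<theta> z)) \<partial>angle) \<partial>gauss2)"
    by (rule nn_integral_rot) simp
  also have "\<dots> = (\<integral>\<^sup>+z. ennreal (\<integral>\<theta>. G (rot \<theta> z) \<partial>angle) \<partial>gauss2)"
    using key by (intro nn_integral_cong_AE) auto
  also have "\<dots> = ennreal (\<integral>z. (\<integral>\<theta>. G (rot \<theta> z) \<partial>angle) \<partial>gauss2)"
    using key gauss2_angle.integrable_fst'[OF RI] by (intro nn_integral_eq_integral) auto
  also have "(\<integral>z. (\<integral>\<theta>. G (rot \<theta> z) \<partial>angle) \<partial>gauss2) = (\<integral>z. G z \<partial>gauss2)"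
    using gauss2_angle.integral_fst'[OF RI] integrable_rot(2)[OF GI] by simp
  finally have nn: "(\<integral>\<^sup>+z. ennreal (D z) \<partial>gauss2) = ennreal (\<integral>z. G z \<partial>gauss2)" .
  have G0: "0 \<le> (\<integral>z. G z \<partial>gauss2)"
  proof -
    have "0 \<le> (\<integral>z. (\<integral>\<theta>. G (rot \<theta> z) \<partial>angle) \<partial>gauss2)"
      using key by (intro integral_nonneg_AE) auto
    then show ?thesis using gauss2_angle.integral_fst'[OF RI] integrable_rot(2)[OF GI] by simp
  qed
  have DI: "integrable gauss2 D"
    using nn D0 by (intro integrableI_nonneg) auto
  then show "integrable gauss2 (\<lambda>z. norm_sq z powr \<gamma> * (deviation h z)\<^sup>2)" by (simp add: D_def[abs_def])
  have "(\<integral>z. D z \<partial>gauss2) = (\<integral>z. G z \<partial>gauss2)"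
    using nn G0 nn_integral_eq_integral[OF DI] D0 by (simp add: ennreal_inj)
  then show "(\<integral>z. norm_sq z powr \<gamma> * (deviation h z)\<^sup>2 \<partial>gauss2) = (\<integral>z. norm_sq z powr \<gamma> * (pair_sum h z * deviation h z) \<partial>gauss2)"
    by (simp add: D_def[abs_def] G_def[abs_def])
qed

section \<open>The linearized form as an expectation over a Gaussian pair and an angle\<close>

text \<open>This is \<open>form_integrand\<close> stripped of its two Gaussian densities, which move
  into the measure; the collision terms combine into a difference of pair sums.\<close>

definition form_kernel :: "real \<Rightarrow> (real \<Rightarrow> real) \<Rightarrow> (real \<times> real) \<times> real \<Rightarrow> real" where
  "form_kernel \<gamma> h p = norm_sq (fst p) powr \<gamma> * (h (fst (fst p)) * (pair_sum h (rot (snd p) (fst p)) - pair_sum h (fst p)))"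

definition reassoc :: "(real \<times> real) \<times> real \<Rightarrow> real \<times> real \<times> real" where
  "reassoc p = (fst (fst p), snd (fst p), snd p)"

lemma reassoc_measurable [measurable]: "reassoc \<in> gauss2 \<Otimes>\<^sub>M angle \<rightarrow>\<^sub>M borel"
proof -
  have "reassoc \<in> (borel \<Otimes>\<^sub>M borel) \<Otimes>\<^sub>M borel \<rightarrow>\<^sub>M borel \<Otimes>\<^sub>M borel \<Otimes>\<^sub>M borel"
    unfolding reassoc_def[abs_def] by measurable
  then have m: "reassoc \<in> borel \<Otimes>\<^sub>M borel \<rightarrow>\<^sub>M borel" by (simp only: borel_prod)
  have E: "sets (gauss2 \<Otimes>\<^sub>M angle) = sets (borel \<Otimes>\<^sub>M borel)"
    by (intro sets_pair_measure_cong) simp_all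
  show ?thesis unfolding measurable_cong_sets[OF E refl] by (rule m)
qed

definition form_weight :: "real \<times> real \<times> real \<Rightarrow> real" where
  "form_weight = (\<lambda>(v, w, \<theta>). exp (- (v\<^sup>2 + w\<^sup>2) / 2) / (2 * pi) * (indicator {-pi..pi} \<theta> / (2 * pi)))"

lemma form_weight_measurable [measurable]: "form_weight \<in> borel_measurable borel"
  unfolding form_weight_def borel_prod[symmetric] by measurable

lemma form_weight_nonneg: "0 \<le> form_weight x"
  by (auto simp: form_weight_def split: prod.split)

lemma nn_integral_lborel_prod:
  fixes f :: "'a::euclidean_space \<times> 'b::euclidean_space \<Rightarrow> ennreal"
  assumes "f \<in> borel_measurable borel"
  shows "(\<integral>\<^sup>+x. \<integral>\<^sup>+y. f (x, y) \<partial>lborel \<partial>lborel) = (\<integral>\<^sup>+z. f z \<partial>lborel)"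
proof -
  have "f \<in> borel_measurable (lborel \<Otimes>\<^sub>M lborel)" using assms by (simp add: lborel_prod)
  from lborel.nn_integral_fst[OF this] show ?thesis by (simp only: lborel_prod)
qed

text \<open>The quadratic form is a Lebesgue integral over a right-nested triple, whereas the
  Gaussian pair and the angle form a left-nested product. This law translates between the two, all
  densities being gathered in \<open>form_weight\<close>.\<close>

lemma distr_reassoc: "distr (gauss2 \<Otimes>\<^sub>M angle) borel reassoc = density lborel (\<lambda>x. ennreal (form_weight x))"
proof (rule measure_eqI)
  fix A assume "A \<in> sets (distr (gauss2 \<Otimes>\<^sub>M angle) borel reassoc)"
  then have A[measurable]: "A \<in> sets borel" by simp
  have A': "A \<in> sets (lborel \<Otimes>\<^sub>M lborel \<Otimes>\<^sub>M lborel)" using A by (simp only: lborel_prod sets_lborel)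
  note [measurable] = A'
  have [measurable]: "form_weight \<in> borel_measurable (lborel \<Otimes>\<^sub>M lborel \<Otimes>\<^sub>M lborel)"
    by (simp add: lborel_prod)
  have ind[measurable]: "(\<lambda>p. indicator A (reassoc p) :: ennreal) \<in> borel_measurable (gauss2 \<Otimes>\<^sub>M angle)"
    by measurable
  have W: "(\<lambda>x. ennreal (form_weight x) * indicator A x) \<in> borel_measurable borel"
    by (intro borel_measurable_times_ennreal measurable_compose[OF form_weight_measurable] borel_measurable_indicator A) simp
  define g where "g v w = (\<integral>\<^sup>+\<theta>. indicator A (v, w, \<theta>) * ennreal (indicator {-pi..pi} \<theta> / (2 * pi)) \<partial>lborel)" for v w :: real
  have "emeasure (distr (gauss2 \<Otimes>\<^sub>M angle) borel reassoc) A = (\<integral>\<^sup>+p. indicator A (reassoc p) \<partial>(gauss2 \<Otimes>\<^sub>M angle))"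
    by (subst nn_integral_indicator[symmetric], simp, subst nn_integral_distr[OF reassoc_measurable]) simp_all
  also have "\<dots> = (\<integral>\<^sup>+z. \<integral>\<^sup>+\<theta>. indicator A (fst z, snd z, \<theta>) \<partial>angle \<partial>gauss2)"
    by (subst angle.nn_integral_fst[symmetric]) (simp_all add: ind reassoc_def)
  also have "\<dots> = (\<integral>\<^sup>+z. g (fst z) (snd z) \<partial>gauss2)"
  proof (rule nn_integral_cong)
    fix z :: "real \<times> real"
    have "(\<integral>\<^sup>+\<theta>. indicator A (fst z, snd z, \<theta>) \<partial>angle)
      = (\<integral>\<^sup>+\<theta>. indicator A (fst z, snd z, \<theta>) * indicator {-pi..pi} \<theta> \<partial>lborel) * ennreal (1 / (2 * pi))"
      by (subst nn_integral_angle) (measurable, simp only: divide_ennreal_def inverse_ennreal_two_pi)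
    also have "\<dots> = (\<integral>\<^sup>+\<theta>. indicator A (fst z, snd z, \<theta>) * indicator {-pi..pi} \<theta> * ennreal (1 / (2 * pi)) \<partial>lborel)"
      by (rule nn_integral_multc[symmetric]) measurable
    also have "\<dots> = g (fst z) (snd z)"
      unfolding g_def by (intro nn_integral_cong) (auto split: split_indicator)
    finally show "(\<integral>\<^sup>+\<theta>. indicator A (fst z, snd z, \<theta>) \<partial>angle) = g (fst z) (snd z)" .
  qed
  also have "\<dots> = (\<integral>\<^sup>+v. \<integral>\<^sup>+w. g v w * ennreal (exp (- (v\<^sup>2 + w\<^sup>2) / 2) / (2 * pi)) \<partial>lborel \<partial>lborel)"
  proof (subst nn_integral_gauss2)
    have "(\<lambda>z. g (fst z) (snd z)) \<in> borel_measurable (lborel \<Otimes>\<^sub>M lborel)"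
      unfolding g_def by measurable
    then show "(\<lambda>z. g (fst z) (snd z)) \<in> borel_measurable borel" by (simp add: lborel_prod)
  qed simp
  also have "\<dots> = (\<integral>\<^sup>+v. \<integral>\<^sup>+w. \<integral>\<^sup>+\<theta>. ennreal (form_weight (v, w, \<theta>)) * indicator A (v, w, \<theta>) \<partial>lborel \<partial>lborel \<partial>lborel)"
  proof (intro nn_integral_cong)
    fix v w :: real
    have "g v w * ennreal (exp (- (v\<^sup>2 + w\<^sup>2) / 2) / (2 * pi))
      = (\<integral>\<^sup>+\<theta>. indicator A (v, w, \<theta>) * ennreal (indicator {-pi..pi} \<theta> / (2 * pi)) * ennreal (exp (- (v\<^sup>2 + w\<^sup>2) / 2) / (2 * pi)) \<partial>lborel)"
      unfolding g_def by (rule nn_integral_multc[symmetric]) measurable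
    also have "\<dots> = (\<integral>\<^sup>+\<theta>. ennreal (form_weight (v, w, \<theta>)) * indicator A (v, w, \<theta>) \<partial>lborel)"
      by (intro nn_integral_cong) (auto simp: form_weight_def ennreal_mult[symmetric] split: split_indicator)
    finally show "g v w * ennreal (exp (- (v\<^sup>2 + w\<^sup>2) / 2) / (2 * pi)) = (\<integral>\<^sup>+\<theta>. ennreal (form_weight (v, w, \<theta>)) * indicator A (v, w, \<theta>) \<partial>lborel)" .
  qed
  also have "\<dots> = (\<integral>\<^sup>+v. \<integral>\<^sup>+y. ennreal (form_weight (v, y)) * indicator A (v, y) \<partial>lborel \<partial>lborel)"
  proof (rule nn_integral_cong)
    fix v :: real
    have "Pair v \<in> borel \<rightarrow>\<^sub>M (borel \<Otimes>\<^sub>M borel :: (real \<times> real \<times> real) measure)"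
      by simp
    then have P: "Pair v \<in> borel \<rightarrow>\<^sub>M (borel :: (real \<times> real \<times> real) measure)"
      by (simp only: borel_prod)
    show "(\<integral>\<^sup>+w. \<integral>\<^sup>+\<theta>. ennreal (form_weight (v, w, \<theta>)) * indicator A (v, w, \<theta>) \<partial>lborel \<partial>lborel)
      = (\<integral>\<^sup>+y. ennreal (form_weight (v, y)) * indicator A (v, y) \<partial>lborel)"
      by (rule nn_integral_lborel_prod[OF measurable_compose[OF P W]])
  qed
  also have "\<dots> = (\<integral>\<^sup>+x. ennreal (form_weight x) * indicator A x \<partial>lborel)"
    by (rule nn_integral_lborel_prod[OF W])
  also have "\<dots> = emeasure (density lborel (\<lambda>x. ennreal (form_weight x))) A"
    by (subst emeasure_density) auto
  finally show "emeasure (distr (gauss2 \<Otimes>\<^sub>M angle) borel reassoc) A = emeasure (density lborel (\<lambda>x. ennreal (form_weight x))) A" .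
qed simp

lemma form_kernel_integral:
  assumes h[measurable]: "h \<in> borel_measurable borel" and c: "form_converges \<gamma> h"
  shows "integrable (gauss2 \<Otimes>\<^sub>M angle) (form_kernel \<gamma> h)"
    and "linearized_form \<gamma> h = 2 * (\<integral>p. form_kernel \<gamma> h p \<partial>(gauss2 \<Otimes>\<^sub>M angle))"
proof -
  define Y where "Y x = form_kernel \<gamma> h ((fst x, fst (snd x)), snd (snd x))" for x
  have Yr: "Y (reassoc p) = form_kernel \<gamma> h p" for p by (simp add: Y_def reassoc_def)
  have [measurable]: "Y \<in> borel_measurable borel"
  proof -
    have "Y \<in> borel_measurable (borel \<Otimes>\<^sub>M borel \<Otimes>\<^sub>M borel)"
      unfolding Y_def[abs_def] form_kernel_def rot_def pair_sum_def fst_conv snd_conv by measurable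
    then show ?thesis by (simp add: borel_prod)
  qed
  have eq: "form_weight x * Y x = 1 / (2 * pi) * (indicator (UNIV \<times> UNIV \<times> {-pi..pi}) x *\<^sub>R form_integrand \<gamma> h x)" for x
  proof -
    obtain v w \<theta> where x: "x = (v, w, \<theta>)" by (metis prod.exhaust)
    have K: "Y x * (std_normal_density v * std_normal_density w) = form_integrand \<gamma> h x"
      unfolding x Y_def form_kernel_def form_integrand_def rot_def pair_sum_def fst_conv snd_conv split Let_def
      by (simp add: power2_eq_square algebra_simps)
    show ?thesis
      unfolding K[symmetric] unfolding x form_weight_def split std_normal_density_mult[symmetric]
      by (auto split: split_indicator)
  qed
  have ci: "integrable lborel (\<lambda>x. form_weight x * Y x)"
    using c unfolding eq form_converges_def set_integrable_def by (intro integrable_mult_right)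
  have di: "integrable (density lborel (\<lambda>x. ennreal (form_weight x))) Y"
    using ci by (subst integrable_density) (auto simp: form_weight_nonneg)
  then have "integrable (gauss2 \<Otimes>\<^sub>M angle) (\<lambda>p. Y (reassoc p))"
    unfolding distr_reassoc[symmetric] by (subst (asm) integrable_distr_eq) auto
  then show "integrable (gauss2 \<Otimes>\<^sub>M angle) (form_kernel \<gamma> h)" by (simp add: Yr)
  have "(\<integral>p. form_kernel \<gamma> h p \<partial>(gauss2 \<Otimes>\<^sub>M angle)) = (\<integral>p. Y (reassoc p) \<partial>(gauss2 \<Otimes>\<^sub>M angle))"
    by (simp add: Yr)
  also have "\<dots> = (\<integral>x. Y x \<partial>density lborel (\<lambda>x. ennreal (form_weight x)))"
    unfolding distr_reassoc[symmetric] by (subst integral_distr) auto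
  also have "\<dots> = (\<integral>x. form_weight x * Y x \<partial>lborel)"
    by (subst integral_density) (auto simp: form_weight_nonneg)
  also have "\<dots> = 1 / (2 * pi) * (LINT p:(UNIV \<times> UNIV \<times> {-pi..pi})|lborel. form_integrand \<gamma> h p)"
    unfolding eq set_lebesgue_integral_def by (rule integral_mult_right_zero)
  \<comment> \<open>The factor 2 is the prefactor \<open>1 / pi\<close> of the form against the
    normalization \<open>1 / (2 * pi)\<close> of the angle.\<close>
  finally show "linearized_form \<gamma> h = 2 * (\<integral>p. form_kernel \<gamma> h p \<partial>(gauss2 \<Otimes>\<^sub>M angle))"
    by (simp add: linearized_form_def)
qed

text \<open>Integrating the kernel over the angle leaves -\<open>F\<close>, and Fubini makes
  \<open>F\<close> integrable. As \<open>deviation h\<close> and the weight are symmetric, adding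
  the swapped copy replaces h(v) by h(v) + h(w) and uses up the factor 2;
  \<open>deviation_rot_form\<close> turns the resulting product into the square.\<close>

lemma linearized_form_eq:
  assumes h[measurable]: "h \<in> borel_measurable borel" and hi: "integrable maxwellian h" and c: "form_converges \<gamma> h"
  shows "integrable gauss2 (\<lambda>z. norm_sq z powr \<gamma> * (deviation h z)\<^sup>2)"
    and "(\<integral>z. norm_sq z powr \<gamma> * (deviation h z)\<^sup>2 \<partial>gauss2) = - linearized_form \<gamma> h"
proof -
  note K = form_kernel_integral[OF h c]
  define F where "F z = norm_sq z powr \<gamma> * (h (fst z) * deviation h z)" for z
  have [measurable]: "F \<in> borel_measurable borel" unfolding F_def[abs_def] by measurable
  have AE: "AE z in gauss2. (\<integral>\<theta>. form_kernel \<gamma> h (z, \<theta>) \<partial>angle) = - F z"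
    using AE_integrable_pair_sum_rot[OF hi]
  proof eventually_elim
    case (elim z)
    have "(\<integral>\<theta>. form_kernel \<gamma> h (z, \<theta>) \<partial>angle) = norm_sq z powr \<gamma> * (h (fst z) * (circle_mean h z - pair_sum h z))"
      unfolding form_kernel_def fst_conv snd_conv integral_mult_right_zero
      using elim angle.prob_space by (subst Bochner_Integration.integral_diff) (auto simp: circle_mean_def)
    then show ?case by (simp add: F_def deviation_def algebra_simps)
  qed
  have m: "(\<lambda>z. \<integral>\<theta>. form_kernel \<gamma> h (z, \<theta>) \<partial>angle) \<in> borel_measurable gauss2"
    using gauss2_angle.integrable_fst'[OF K(1)] by simp
  have "integrable gauss2 (\<lambda>z. - F z)"
    using integrable_cong_AE[OF m _ AE] gauss2_angle.integrable_fst'[OF K(1)] by simp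
  then have FI: "integrable gauss2 F" by simp
  have "(\<integral>z. - F z \<partial>gauss2) = (\<integral>p. form_kernel \<gamma> h p \<partial>(gauss2 \<Otimes>\<^sub>M angle))"
    using integral_cong_AE[OF m _ AE] gauss2_angle.integral_fst'[OF K(1)] by simp
  then have Fint: "2 * (\<integral>z. F z \<partial>gauss2) = - linearized_form \<gamma> h" using K(2) by simp
  have split: "norm_sq z powr \<gamma> * (pair_sum h z * deviation h z) = F z + F (prod.swap z)" for z
    by (simp add: F_def deviation_swap pair_sum_def algebra_simps)
  note S = gauss2_swap[OF FI]
  have I: "integrable gauss2 (\<lambda>z. norm_sq z powr \<gamma> * (pair_sum h z * deviation h z))"
    unfolding split using FI S(1) by simp
  have Q: "(\<integral>z. norm_sq z powr \<gamma> * (pair_sum h z * deviation h z) \<partial>gauss2) = - linearized_form \<gamma> h"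
    unfolding split using FI S Fint by simp
  show "integrable gauss2 (\<lambda>z. norm_sq z powr \<gamma> * (deviation h z)\<^sup>2)"
    and "(\<integral>z. norm_sq z powr \<gamma> * (deviation h z)\<^sup>2 \<partial>gauss2) = - linearized_form \<gamma> h"
    using deviation_rot_form[OF h hi I] Q by simp_all
qed

section \<open>The trial functions\<close>

lemma integrable_maxwellian_power: "integrable maxwellian (\<lambda>v. v ^ k)"
  unfolding maxwellian_def using integrable_std_normal_moment[of k]
  by (subst integrable_density) auto

text \<open>By \<open>2 * \<bar>a * b\<bar> \<le> a\<^sup>2 + b\<^sup>2\<close>, square
  integrability of \<open>h\<close> and the Gaussian moments give all moments of
  \<open>h\<close>.\<close>

lemma integrable_maxwellian_mult_power:
  assumes [measurable]: "h \<in> borel_measurable borel" and h2: "integrable maxwellian (\<lambda>v. (h v)\<^sup>2)"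
  shows "integrable maxwellian (\<lambda>v. h v * v ^ k)"
proof (rule Bochner_Integration.integrable_bound)
  show "integrable maxwellian (\<lambda>v. (h v)\<^sup>2 + v ^ (2 * k))"
    using h2 integrable_maxwellian_power by simp
  show "AE v in maxwellian. norm (h v * v ^ k) \<le> norm ((h v)\<^sup>2 + v ^ (2 * k))"
  proof (rule AE_I2)
    fix v
    have "2 * (\<bar>h v\<bar> * \<bar>v ^ k\<bar>) \<le> (h v)\<^sup>2 + (v ^ k)\<^sup>2"
      using sum_squares_bound[of "\<bar>h v\<bar>" "\<bar>v ^ k\<bar>"] by (simp add: mult.assoc)
    moreover have "0 \<le> \<bar>h v\<bar> * \<bar>v ^ k\<bar>" by simp
    moreover have "norm ((h v)\<^sup>2 + v ^ (2 * k)) = (h v)\<^sup>2 + (v ^ k)\<^sup>2" by (simp add: power_even_eq)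
    moreover have "norm (h v * v ^ k) = \<bar>h v\<bar> * \<bar>v ^ k\<bar>" by (simp only: real_norm_def abs_mult)
    ultimately show "norm (h v * v ^ k) \<le> norm ((h v)\<^sup>2 + v ^ (2 * k))"
      by linarith
  qed
qed measurable

text \<open>Expansion into monomials in v and w, each of which factorizes. In every product of
  moments one has order 0, except in that of the two second moments; vanishing moments of orders 0
  and 2 therefore annihilate the whole expression.\<close>

lemma gauss2_prod_quadratic_moment:
  fixes f g :: "real \<Rightarrow> real" and a b :: real
  assumes f: "\<And>k. integrable maxwellian (\<lambda>v. f v * v ^ k)" and g: "\<And>k. integrable maxwellian (\<lambda>v. g v * v ^ k)"
  defines "m \<equiv> \<lambda>u k. \<integral>v. u v * v ^ k \<partial>maxwellian"
  shows "integrable gauss2 (\<lambda>z. f (fst z) * g (snd z) * (a * norm_sq z + b * (norm_sq z)\<^sup>2))" (is ?I)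
    and "(\<integral>z. f (fst z) * g (snd z) * (a * norm_sq z + b * (norm_sq z)\<^sup>2) \<partial>gauss2)
      = a * (m f 2 * m g 0 + m f 0 * m g 2) + b * (m f 4 * m g 0 + 2 * (m f 2 * m g 2) + m f 0 * m g 4)" (is ?E)
proof -
  define P where "P k l z = (f (fst z) * fst z ^ k) * (g (snd z) * snd z ^ l)" for k l and z :: "real \<times> real"
  have P: "integrable gauss2 (P k l)" "(\<integral>z. P k l z \<partial>gauss2) = m f k * m g l" for k l
    unfolding P_def[abs_def] m_def using integrable_gauss2_prod[OF f g] by simp_all
  have eq: "f (fst z) * g (snd z) * (a * norm_sq z + b * (norm_sq z)\<^sup>2)
    = a * (P 2 0 z + P 0 2 z) + b * (P 4 0 z + 2 * P 2 2 z + P 0 4 z)" for z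
    unfolding P_def by (simp add: power2_eq_square power4_eq_xxxx algebra_simps)
  show ?I unfolding eq using P(1) by simp
  show ?E unfolding eq using P by simp
qed

lemma card_ordered_pairs: "finite {(i, j). i < j \<and> j < (N::nat)}" "card {(i, j). i < j \<and> j < N} = N choose 2"
proof (induction N)
  case (Suc N)
  have eq: "{(i, j). i < j \<and> j < Suc N} = {(i, j). i < j \<and> j < N} \<union> (\<lambda>i. (i, N)) ` {..<N}"
    by (auto simp: less_Suc_eq)
  { case 1 show ?case unfolding eq using Suc.IH by simp }
  { case 2
    have "card {(i, j). i < j \<and> j < Suc N} = (N choose 2) + N"
      unfolding eq using Suc.IH by (subst card_Un_disjoint) (auto simp: card_image inj_on_def)
    also have "\<dots> = Suc N choose 2" by (simp add: numeral_2_eq_2)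
    finally show ?case . }
qed auto

text \<open>The link to the set integral in \<open>kac_average\<close>. Measurability is enough,
  since both sides default to 0 for a function that is not integrable.\<close>

lemma integral_angle:
  fixes f :: "real \<Rightarrow> real"
  assumes [measurable]: "f \<in> borel_measurable borel"
  shows "(\<integral>\<theta>. f \<theta> \<partial>angle) = 1 / (2 * pi) * (LINT \<theta>:{-pi..pi}|lborel. f \<theta>)"
proof -
  have A: "angle = density lborel (\<lambda>\<theta>. ennreal (indicator {-pi..pi} \<theta> * (1 / (2 * pi))))"
    unfolding angle_def uniform_measure_def
    by (intro density_cong AE_I2) (auto simp: divide_ennreal_def inverse_ennreal_two_pi split: split_indicator)
  have "(\<integral>\<theta>. f \<theta> \<partial>angle) = (\<integral>\<theta>. (indicator {-pi..pi} \<theta> * (1 / (2 * pi))) * f \<theta> \<partial>lborel)"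
    unfolding A by (subst integral_density) auto
  also have "\<dots> = (\<integral>\<theta>. 1 / (2 * pi) * (indicator {-pi..pi} \<theta> *\<^sub>R f \<theta>) \<partial>lborel)"
    by (intro Bochner_Integration.integral_cong) auto
  finally show ?thesis unfolding set_lebesgue_integral_def by (simp only: integral_mult_right_zero)
qed

section \<open>The trial function at a fixed number of coordinates\<close>

locale kac_test_function =
  fixes N :: nat and h :: "real \<Rightarrow> real"
  assumes N: "4 \<le> N" and h [measurable]: "h \<in> borel_measurable borel"
    and h2: "integrable maxwellian (\<lambda>v. (h v)\<^sup>2)"
begin

definition mean where "mean = pair_expectation N (\<lambda>z. h (fst z))"
definition correlation where "correlation = pair_expectation N (\<lambda>z. h (fst z) * h (snd z))"
definition second_moment where "second_moment = pair_expectation N (\<lambda>z. (h (fst z))\<^sup>2)"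
text \<open>The variance of the sum of the \<open>h (v k)\<close> divided by N: there are N second
  moments and N(N-1) correlations, less the square of N times the mean.\<close>

definition var_rate where "var_rate = second_moment + (real N - 1) * correlation - real N * mean\<^sup>2"

definition centered :: "(nat \<Rightarrow> real) \<Rightarrow> real" where
  "centered v = (\<Sum>k<N. h (v k) - mean)"

sublocale S: prob_space "sphere_measure N" by (rule prob_space_sphere_measure)

lemma h_int: "integrable maxwellian h"
  using integrable_maxwellian_mult_power[OF h h2, of 0] by simp

lemma gauss2_integrable:
  "integrable gauss2 (\<lambda>z. h (fst z))" "integrable gauss2 (\<lambda>z. (h (fst z))\<^sup>2)"
  "integrable gauss2 (\<lambda>z. h (fst z) * h (snd z))"
  using integrable_gauss2_prod(1)[OF h_int, of "\<lambda>_. 1"] integrable_gauss2_prod(1)[OF h2, of "\<lambda>_. 1"]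
    integrable_gauss2_prod(1)[OF h_int h_int] by simp_all

lemma coordinate_integral:
  assumes k: "k < N"
  shows "integrable (sphere_measure N) (\<lambda>v. h (v k))" "(\<integral>v. h (v k) \<partial>sphere_measure N) = mean"
    "integrable (sphere_measure N) (\<lambda>v. (h (v k))\<^sup>2)" "(\<integral>v. (h (v k))\<^sup>2 \<partial>sphere_measure N) = second_moment"
proof -
  \<comment> \<open>The law of one coordinate is read off from that of a pair, with any other index
    as the second member.\<close>
  obtain j where j: "j < N" "k \<noteq> j"
    using N k by (intro that[of "if k = 0 then 1 else 0"]) auto
  note I = sphere_pair_integral[OF k j N]
  show "integrable (sphere_measure N) (\<lambda>v. h (v k))" "(\<integral>v. h (v k) \<partial>sphere_measure N) = mean"
    using I[OF gauss2_integrable(1)] by (simp_all add: mean_def)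
  show "integrable (sphere_measure N) (\<lambda>v. (h (v k))\<^sup>2)" "(\<integral>v. (h (v k))\<^sup>2 \<partial>sphere_measure N) = second_moment"
    using I[OF gauss2_integrable(2)] by (simp_all add: second_moment_def)
qed

lemma coordinate_product_integral:
  assumes "k < N" "l < N" "k \<noteq> l"
  shows "integrable (sphere_measure N) (\<lambda>v. h (v k) * h (v l))" "(\<integral>v. h (v k) * h (v l) \<partial>sphere_measure N) = correlation"
  using sphere_pair_integral[OF assms N gauss2_integrable(3)] by (simp_all add: correlation_def)

lemma centered_integral: "integrable (sphere_measure N) centered" "(\<integral>v. centered v \<partial>sphere_measure N) = 0"
proof -
  show "integrable (sphere_measure N) centered"
    unfolding centered_def[abs_def] using coordinate_integral(1)
    by (intro Bochner_Integration.integrable_sum Bochner_Integration.integrable_diff) auto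
  show "(\<integral>v. centered v \<partial>sphere_measure N) = 0"
    unfolding centered_def using coordinate_integral(1,2) S.prob_space
    by (subst Bochner_Integration.integral_sum) auto
qed

lemma centered_square:
  shows "integrable (sphere_measure N) (\<lambda>v. (centered v)\<^sup>2)"
    and "(\<integral>v. (centered v)\<^sup>2 \<partial>sphere_measure N) = real N * var_rate"
proof -
  define C where "C k l v = (h (v k) - mean) * (h (v l) - mean)" for k l and v :: "nat \<Rightarrow> real"
  have sq: "(centered v)\<^sup>2 = (\<Sum>k<N. \<Sum>l<N. C k l v)" for v
    by (simp add: centered_def power2_eq_square sum_product C_def)
  have C_eq: "C k l v = h (v k) * h (v l) - mean * h (v k) - mean * h (v l) + mean\<^sup>2" for k l v
    by (simp add: C_def power2_eq_square algebra_simps)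
  have CI: "integrable (sphere_measure N) (C k l)
      \<and> (\<integral>v. C k l v \<partial>sphere_measure N) = (if k = l then second_moment else correlation) - mean\<^sup>2"
    if "k < N" "l < N" for k l
  proof (cases "k = l")
    case True
    show ?thesis
      unfolding C_eq[abs_def] True using coordinate_integral[OF that(2)] S.prob_space
      by (simp add: power2_eq_square)
  next
    case False
    show ?thesis
      unfolding C_eq[abs_def] using coordinate_integral(1,2)[OF that(1)] coordinate_integral(1,2)[OF that(2)]
        coordinate_product_integral[OF that False] S.prob_space False
      by (simp add: power2_eq_square)
  qed
  show "integrable (sphere_measure N) (\<lambda>v. (centered v)\<^sup>2)"
    unfolding sq using CI by (intro Bochner_Integration.integrable_sum) auto
  have "(\<integral>v. (centered v)\<^sup>2 \<partial>sphere_measure N) = (\<Sum>k<N. \<Sum>l<N. (if k = l then second_moment else correlation) - mean\<^sup>2)"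
    unfolding sq using CI
    by (subst Bochner_Integration.integral_sum, fastforce intro!: Bochner_Integration.integrable_sum,
        intro sum.cong refl, subst Bochner_Integration.integral_sum, fastforce, auto)
  also have "\<dots> = (\<Sum>k<N. \<Sum>l<N. (correlation - mean\<^sup>2) + (if k = l then second_moment - correlation else 0))"
    by (intro sum.cong) auto
  also have "\<dots> = real N * var_rate"
  proof -
    have "(\<Sum>k<N. \<Sum>l<N. d + (if k = l then s else 0)) = real N * (real N * d) + real N * s" for d s :: real
      by (simp add: sum.distrib distrib_left)
    then show ?thesis unfolding var_rate_def by (simp only:) (simp add: algebra_simps)
  qed
  finally show "(\<integral>v. (centered v)\<^sup>2 \<partial>sphere_measure N) = real N * var_rate" .
qed

lemma centered_kac_rotation:
  assumes "i < N" "j < N" "i \<noteq> j"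
  shows "centered (kac_rotation i j \<theta> v)
    = centered v - pair_sum h (v i, v j) + pair_sum h (rot \<theta> (v i, v j))"
proof -
  have split: "centered u = (h (u i) - mean) + (h (u j) - mean) + (\<Sum>k\<in>{..<N} - {i, j}. h (u k) - mean)" for u
  proof -
    have "{..<N} = insert i (insert j ({..<N} - {i, j}))" using assms by auto
    then have "centered u = (\<Sum>k\<in>insert i (insert j ({..<N} - {i, j})). h (u k) - mean)"
      unfolding centered_def by simp
    then show ?thesis using assms by (simp add: add.assoc)
  qed
  have "(\<Sum>k\<in>{..<N} - {i, j}. h (kac_rotation i j \<theta> v k) - mean) = (\<Sum>k\<in>{..<N} - {i, j}. h (v k) - mean)"
    by (intro sum.cong) (auto simp: kac_rotation_def)
  then show ?thesis
    using assms by (simp add: split pair_sum_def kac_rotation_def rot_def)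
qed

text \<open>The rotation changes only the pair sum, so the average replaces it by its circle mean.
  This needs a circle on which the pair sum is integrable; the exceptional points are null for the
  Gaussian, hence also for the pair law, which has a density with respect to it.\<close>

lemma AE_kac_average:
  assumes ij: "i < N" "j < N" "i \<noteq> j"
  shows "AE v in sphere_measure N. centered v / c - kac_average i j (\<lambda>v. centered v / c) v = deviation h (v i, v j) / c"
proof -
  have "AE z in distr (sphere_measure N) borel (\<lambda>v. (v i, v j)). integrable angle (\<lambda>\<theta>. pair_sum h (rot \<theta> z))"
    unfolding distr_sphere_pair(2)[OF ij N]
    using AE_integrable_pair_sum_rot[OF h_int] by (subst AE_density) auto
  from AE_distrD[OF sphere_coordinate_pair_measurable[OF ij(1,2)] this]
  show ?thesis
  proof eventually_elim
    case (elim v)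
    define z where "z = (v i, v j)"
    have m: "(\<lambda>\<theta>. pair_sum h (rot \<theta> z)) \<in> borel_measurable borel"
      by (rule measurable_compose[OF rot_measurable_angle]) simp
    have "kac_average i j (\<lambda>v. centered v / c) v = (\<integral>\<theta>. (centered v - pair_sum h z + pair_sum h (rot \<theta> z)) / c \<partial>angle)"
      unfolding kac_average_def centered_kac_rotation[OF ij] z_def[symmetric]
      using m by (intro integral_angle[symmetric]) simp
    also have "\<dots> = (centered v - pair_sum h z + circle_mean h z) / c"
      using elim angle.prob_space by (simp add: z_def circle_mean_def)
    finally show ?case by (simp add: deviation_def z_def diff_divide_distrib[symmetric])
  qed
qed

text \<open>The normalized trial function competes in the infimum. All pairs of coordinates have the
  same bound \<open>E / V\<close>, so the number of pairs cancels against the binomial prefactor,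
  and the factor N cancels against \<open>V = N * var_rate\<close>.\<close>

lemma restricted_kac_gap_le:
  assumes D: "integrable gauss2 (\<lambda>z. norm_sq z powr \<gamma> * (deviation h z)\<^sup>2)" and pos: "0 < var_rate"
  shows "restricted_kac_gap \<gamma> N \<le> ereal (pair_expectation N (\<lambda>z. norm_sq z powr \<gamma> * (deviation h z)\<^sup>2) / var_rate)"
proof -
  define E where "E = pair_expectation N (\<lambda>z. norm_sq z powr \<gamma> * (deviation h z)\<^sup>2)"
  define V where "V = real N * var_rate"
  define c where "c = sqrt V"
  define f where "f v = centered v / c" for v
  have V: "V > 0" using pos N by (simp add: V_def)
  have c: "c > 0" "c\<^sup>2 = V" using V by (simp_all add: c_def)
  have f2: "(f v)\<^sup>2 = (centered v)\<^sup>2 / V" for v by (simp add: f_def power_divide c(2))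
  have fI: "integrable (sphere_measure N) f" "(\<integral>v. f v \<partial>sphere_measure N) = 0"
    unfolding f_def using centered_integral by simp_all
  have f2I: "integrable (sphere_measure N) (\<lambda>v. (f v)\<^sup>2)" "(\<integral>v. (f v)\<^sup>2 \<partial>sphere_measure N) = 1"
    unfolding f2 using centered_square V by (simp_all add: V_def[symmetric])
  have "f \<in> additive_functions N"
    unfolding additive_functions_def L2_space_def
  proof (intro CollectI conjI IntI bexI)
    show "f \<in> borel_measurable (sphere_measure N)" using fI by auto
    show "integrable (sphere_measure N) (\<lambda>v. (f v)\<^sup>2)" by (rule f2I)
    show "AE v in sphere_measure N. f v = (\<Sum>j<N. (\<lambda>x. (h x - mean) / c) (v j))"
      by (simp add: f_def centered_def sum_divide_distrib)
  qed measurable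
  then have "restricted_kac_gap \<gamma> N \<le> ereal (kac_form \<gamma> N f)"
    unfolding restricted_kac_gap_def using fI f2I by (intro INF_lower) auto
  also have "kac_form \<gamma> N f \<le> E / var_rate"
  proof -
    have summand_le: "(LINT v|sphere_measure N. ((v i)\<^sup>2 + (v j)\<^sup>2) powr \<gamma> * (f v - kac_average i j f v)\<^sup>2) \<le> E / V"
      if "i < j" "j < N" for i j
    proof -
      define L where "L v = ((v i)\<^sup>2 + (v j)\<^sup>2) powr \<gamma> * (f v - kac_average i j f v)\<^sup>2" for v
      define R where "R z = norm_sq z powr \<gamma> * (deviation h z)\<^sup>2 / V" for z
      have ij: "i < N" "j < N" "i \<noteq> j" using that by auto
      have RI: "integrable gauss2 R" unfolding R_def[abs_def] using D by simp
      note SR = sphere_pair_integral[OF ij N RI]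
      have SRe: "(\<integral>v. R (v i, v j) \<partial>sphere_measure N) = E / V"
        unfolding SR(2) by (simp add: pair_expectation_def R_def E_def)
      have E0: "0 \<le> E / V"
        unfolding SRe[symmetric] using V by (intro integral_nonneg_AE) (simp add: R_def)
      have AE: "AE v in sphere_measure N. L v = R (v i, v j)"
        using AE_kac_average[OF ij, of c] unfolding f_def[abs_def, symmetric]
        by eventually_elim (simp add: L_def R_def power_divide c(2) f_def)
      show ?thesis
      \<comment> \<open>Measurability of the integrand, which contains \<open>kac_average\<close>,
        is left undecided. A nonmeasurable function has integral 0 by convention, and as only an
        upper bound by the nonnegative \<open>E / V\<close> is wanted, both cases are
        harmless.\<close>
      proof (cases "L \<in> borel_measurable (sphere_measure N)")
        case True
        then have "(\<integral>v. L v \<partial>sphere_measure N) = E / V"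
          using integral_cong_AE[OF True _ AE] SR(1) SRe by auto
        then show ?thesis by (simp add: L_def)
      next
        case False
        then have "(\<integral>v. L v \<partial>sphere_measure N) = 0"
          by (intro not_integrable_integral_eq) auto
        then show ?thesis using E0 by (simp add: L_def)
      qed
    qed
    have "(\<Sum>(i, j) \<in> {(i, j). i < j \<and> j < N}. LINT v|sphere_measure N. ((v i)\<^sup>2 + (v j)\<^sup>2) powr \<gamma> * (f v - kac_average i j f v)\<^sup>2)
      \<le> (\<Sum>(i, j) \<in> {(i, j). i < j \<and> j < N}. E / V)"
      using summand_le by (intro sum_mono) auto
    also have "\<dots> = real (N choose 2) * (E / V)"
      by (simp add: case_prod_unfold card_ordered_pairs[unfolded case_prod_unfold])
    finally have "kac_form \<gamma> N f \<le> real N / real (N choose 2) * (real (N choose 2) * (E / V))"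
      unfolding kac_form_def by (intro mult_left_mono) auto
    also have "\<dots> = E / var_rate"
      using N pos zero_less_binomial[of 2 N] by (simp add: V_def)
    finally show ?thesis .
  qed
  finally show ?thesis by (simp add: E_def)
qed

end

section \<open>Passage to the limit for a fixed admissible function\<close>

theorem theorem1p5:
  fixes \<gamma> :: real
  assumes "0 \<le> \<gamma>" and "\<gamma> < 1"
  shows "linearized_gap \<gamma> \<ge> limsup (\<lambda>N. restricted_kac_gap \<gamma> N)"
  unfolding linearized_gap_def
proof (rule INF_greatest)
  fix h
  assume "h \<in> {h \<in> L2_space maxwellian.
                 \<not> (AE v in maxwellian. h v = 0) \<and> form_converges \<gamma> h \<and>
                 (LINT v|maxwellian. h v) = 0 \<and> (LINT v|maxwellian. v\<^sup>2 * h v) = 0}"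
  then have h: "h \<in> borel_measurable borel" and h2: "integrable maxwellian (\<lambda>v. (h v)\<^sup>2)"
    and h_nz: "\<not> (AE v in maxwellian. h v = 0)" and conv: "form_converges \<gamma> h"
    and h_0: "(\<integral>v. h v \<partial>maxwellian) = 0" and h_2: "(\<integral>v. h v * v\<^sup>2 \<partial>maxwellian) = 0"
    by (auto simp: L2_space_def mult.commute cong: measurable_cong_sets)
  note pow = integrable_maxwellian_mult_power[OF h h2]
  have one: "integrable maxwellian (\<lambda>v. 1 * v ^ k)" for k using integrable_maxwellian_power by simp
  have hi: "integrable maxwellian h" using pow[of 0] by simp
  define Q where "Q = (\<lambda>z. norm_sq z powr \<gamma> * (deviation h z)\<^sup>2)"
  note lin = linearized_form_eq[OF h hi conv, folded Q_def]
  define e where "e F N = pair_expectation N F" for F N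
  let ?F1 = "\<lambda>z :: real \<times> real. h (fst z)"
  let ?F2 = "\<lambda>z :: real \<times> real. h (fst z) * h (snd z)"
  let ?F0 = "\<lambda>z :: real \<times> real. (h (fst z))\<^sup>2"
  define H where "H = (\<integral>v. (h v)\<^sup>2 \<partial>maxwellian)"
  have H: "H > 0"
  proof -
    have "H \<noteq> 0"
      unfolding H_def using h_nz h2 by (subst integral_nonneg_eq_0_iff_AE) auto
    moreover have "0 \<le> H" unfolding H_def by simp
    ultimately show ?thesis by simp
  qed
  have F1: "integrable gauss2 ?F1" "(\<integral>z. ?F1 z \<partial>gauss2) = 0"
    using integrable_gauss2_prod[OF hi, of "\<lambda>_. 1"] h_0 by simp_all
  have F2: "integrable gauss2 ?F2" "(\<integral>z. ?F2 z \<partial>gauss2) = 0"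
    using integrable_gauss2_prod[OF hi hi] h_0 by simp_all
  have F0: "integrable gauss2 ?F0" "(\<integral>z. ?F0 z \<partial>gauss2) = H"
    using integrable_gauss2_prod[OF h2, of "\<lambda>_. 1"] maxwellian.prob_space by (simp_all add: H_def)
  \<comment> \<open>The limit may be nonzero, because \<open>h\<close> is not orthogonal to
    \<open>v ^ 4\<close> in general. The variance contains only N times the square of the mean,
    which is the square of this sequence divided by N.\<close>
  have "(\<lambda>N. real N * e ?F1 N) \<longlonglongrightarrow> (\<integral>z. ?F1 z * (2 * norm_sq z - (norm_sq z)\<^sup>2 / 4) \<partial>gauss2)"
    unfolding e_def using gauss2_prod_quadratic_moment(1)[OF pow one, of 2 1]
    by (intro pair_expectation_first_order[OF F1]) simp
  from tendsto_mult[OF tendsto_power[OF this, of 2] lim_inverse_n]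
  have L1: "(\<lambda>N. (real N * e ?F1 N)\<^sup>2 * inverse (real N)) \<longlonglongrightarrow> 0" by simp
  have "(\<lambda>N. real N * e ?F2 N) \<longlonglongrightarrow> (\<integral>z. ?F2 z * (2 * norm_sq z - (norm_sq z)\<^sup>2 / 4) \<partial>gauss2)"
    unfolding e_def using gauss2_prod_quadratic_moment(1)[OF pow pow, of 2 1]
    by (intro pair_expectation_first_order[OF F2]) simp
  \<comment> \<open>The moments of orders 0 and 2 of \<open>h\<close> vanish, which removes every
    term of the quadratic polynomial, the mixed one included.\<close>
  also have "(\<integral>z. ?F2 z * (2 * norm_sq z - (norm_sq z)\<^sup>2 / 4) \<partial>gauss2) = 0"
    using gauss2_prod_quadratic_moment(2)[OF pow pow, of 2 "- 1/4"] h_0 h_2 by simp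
  \<comment> \<open>One correlation is subtracted because \<open>var_rate\<close> carries the factor
    N - 1; by itself it tends to 0.\<close>
  finally have L2: "(\<lambda>N. real N * e ?F2 N - e ?F2 N) \<longlonglongrightarrow> 0 - 0"
    using pair_expectation_tendsto[OF F2(1)] F2(2) by (intro tendsto_diff) (simp_all add: e_def)
  have L0: "e ?F0 \<longlonglongrightarrow> H" using pair_expectation_tendsto[OF F0(1)] F0(2) by (simp add: e_def[abs_def])
  define r where "r N = kac_test_function.var_rate N h" for N
  have loc: "kac_test_function N h" if "4 \<le> N" for N
    using that h h2 by unfold_locales
  have "(\<lambda>N. e ?F0 N + (real N * e ?F2 N - e ?F2 N) - (real N * e ?F1 N)\<^sup>2 * inverse (real N)) \<longlonglongrightarrow> H + (0 - 0) - 0"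
    by (intro tendsto_add tendsto_diff[OF _ L1] L0 L2)
  moreover have "eventually (\<lambda>N. e ?F0 N + (real N * e ?F2 N - e ?F2 N) - (real N * e ?F1 N)\<^sup>2 * inverse (real N) = r N) sequentially"
    using eventually_ge_at_top[of 4]
  proof eventually_elim
    case (elim N)
    interpret kac_test_function N h by (rule loc[OF elim])
    have "(real N * e ?F1 N)\<^sup>2 * inverse (real N) = real N * (e ?F1 N)\<^sup>2"
      using elim by (simp add: power2_eq_square field_simps)
    moreover have "r N = e ?F0 N + (real N - 1) * e ?F2 N - real N * (e ?F1 N)\<^sup>2"
      by (simp add: r_def var_rate_def mean_def correlation_def second_moment_def e_def)
    ultimately show ?case by (simp add: left_diff_distrib)
  qed
  ultimately have r: "r \<longlonglongrightarrow> H" by (simp add: tendsto_cong)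
  \<comment> \<open>The limit \<open>H\<close> of \<open>r\<close> is positive, so the trial
    function can be normalized for all large N.\<close>
  have le: "eventually (\<lambda>N. restricted_kac_gap \<gamma> N \<le> ereal (e Q N / r N)) sequentially"
    using eventually_ge_at_top[of 4] order_tendstoD(1)[OF r H]
  proof eventually_elim
    case (elim N)
    interpret kac_test_function N h by (rule loc[OF elim(1)])
    show ?case
      using restricted_kac_gap_le[of \<gamma>] lin(1) elim(2) by (simp add: Q_def e_def r_def)
  qed
  have "(\<lambda>N. e Q N / r N) \<longlonglongrightarrow> - linearized_form \<gamma> h / H"
    using pair_expectation_tendsto[OF lin(1)] lin(2) r H unfolding e_def by (intro tendsto_divide) auto
  then have "limsup (\<lambda>N. ereal (e Q N / r N)) = ereal (- linearized_form \<gamma> h / H)"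
    by (intro lim_imp_Limsup) auto
  then show "limsup (restricted_kac_gap \<gamma>) \<le> ereal (- linearized_form \<gamma> h / (\<integral>v. (h v)\<^sup>2 \<partial>maxwellian))"
    using Limsup_mono[OF le] by (simp add: H_def)
qed

end
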